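(* Let $(R,\mathfrak m,k)$ be a complete approximately Gorenstein Noetherian local ring. Let $\mathrm{cl}$ be a functorial and residual closure operation. Let $\{J_t\}_{t\in\mathbb N}$ be a sequence of irreducible $\mathfrak m$-primary ideals that is cofinal with the powers of $\mathfrak m$ and such that each $J_t$ is $\mathrm{cl}$-closed (i.e. $(J_t)^{\mathrm{cl}}_R=J_t$). Then for every ideal $I$ of $R$ we have $I^{\mathrm{cl}}_R=I$, and for every finitely generated $R$-module $M$ we have $0^{\mathrm{cl}}_M=0$.
   Context: A closure operation (here on a class of $R$-modules closed under submodules and quotients and containing all finitely generated modules) assigns to $L\subseteq M$ a module $L\subseteq L^{\mathrm{cl}}_M\subseteq M$ with $(L^{\mathrm{cl}}_M)^{\mathrm{cl}}_M=L^{\mathrm{cl}}_M$ and $L\subseteq N\subseteq M\Rightarrow L^{\mathrm{cl}}_M\subseteq N^{\mathrm{cl}}_M$. It is residual if $(\ker q)^{\mathrm{cl}}_M=q^{-1}(0^{\mathrm{cl}}_P)$ for every surjection $q:M\twoheadrightarrow P$; it is functorial if $g(L^{\mathrm{cl}}_M)\subseteq g(L)^{\mathrm{cl}}_N$ for every homomorphism $g:M\to N$ and $L\subseteq M$ (for a residual closure, equivalently $g(0^{\mathrm{cl}}_M)\subseteq0^{\mathrm{cl}}_N$). An ideal is irreducible if it is not the intersection of two strictly larger ideals. A Noetherian local ring is approximately Gorenstein if it has a decreasing sequence of irreducible $\mathfrak m$-primary ideals cofinal with the powers of $\mathfrak m$. *)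

theory Defs
  imports "HOL-Algebra.Module" "HOL-Algebra.Ring_Divisibility" "HOL-Algebra.Ideal_Product"
begin

section \<open>Local rings and their ideals\<close>

locale noetherian_local_ring = cring R + noetherian_ring R for R (structure) +
  fixes \<mm>
  assumes maximal: "maximalideal \<mm> R"
    and maximal_unique: "maximalideal \<nn> R \<Longrightarrow> \<nn> = \<mm>"

(* ideals_set R is the multiplicative structure on the ideals of R, with unit carrier R. *)
abbreviation ideal_power :: "('a, 'r) ring_scheme \<Rightarrow> 'a set \<Rightarrow> nat \<Rightarrow> 'a set" where
  "ideal_power R I n \<equiv> I [^]\<^bsub>ideals_set R\<^esub> n"

(* Uniqueness of limits is the separatedness part of completeness. *)
definition adically_complete :: "('a, 'r) ring_scheme \<Rightarrow> 'a set \<Rightarrow> bool" where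
  "adically_complete R I \<longleftrightarrow>
     (\<forall>x :: nat \<Rightarrow> 'a.
        (\<forall>i. x i \<in> carrier R) \<and>
        (\<forall>n. \<exists>N. \<forall>i\<ge>N. \<forall>j\<ge>N. x i \<ominus>\<^bsub>R\<^esub> x j \<in> ideal_power R I n) \<longrightarrow>
        (\<exists>!l. l \<in> carrier R \<and> (\<forall>n. \<exists>N. \<forall>i\<ge>N. x i \<ominus>\<^bsub>R\<^esub> l \<in> ideal_power R I n)))"

definition radical :: "('a, 'r) ring_scheme \<Rightarrow> 'a set \<Rightarrow> 'a set" where
  "radical R J = {a \<in> carrier R. \<exists>n :: nat. a [^]\<^bsub>R\<^esub> n \<in> J}"

definition primary_ideal :: "('a, 'r) ring_scheme \<Rightarrow> 'a set \<Rightarrow> bool" where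
  "primary_ideal R J \<longleftrightarrow> ideal J R \<and> J \<noteq> carrier R \<and>
     (\<forall>a \<in> carrier R. \<forall>b \<in> carrier R. a \<otimes>\<^bsub>R\<^esub> b \<in> J \<longrightarrow> a \<in> J \<or> b \<in> radical R J)"

definition primary_to :: "('a, 'r) ring_scheme \<Rightarrow> 'a set \<Rightarrow> 'a set \<Rightarrow> bool" where
  "primary_to R \<mm> J \<longleftrightarrow> primary_ideal R J \<and> radical R J = \<mm>"

definition irreducible_ideal :: "('a, 'r) ring_scheme \<Rightarrow> 'a set \<Rightarrow> bool" where
  "irreducible_ideal R J \<longleftrightarrow> ideal J R \<and>
     \<not> (\<exists>A B. ideal A R \<and> ideal B R \<and> J \<subset> A \<and> J \<subset> B \<and> J = A \<inter> B)"

definition cofinal_with_powers :: "('a, 'r) ring_scheme \<Rightarrow> 'a set \<Rightarrow> (nat \<Rightarrow> 'a set) \<Rightarrow> bool" where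
  "cofinal_with_powers R \<mm> J \<longleftrightarrow>
     (\<forall>n. \<exists>t. J t \<subseteq> ideal_power R \<mm> n) \<and> (\<forall>t. \<exists>n. ideal_power R \<mm> n \<subseteq> J t)"

definition approximately_gorenstein :: "('a, 'r) ring_scheme \<Rightarrow> 'a set \<Rightarrow> bool" where
  "approximately_gorenstein R \<mm> \<longleftrightarrow> noetherian_local_ring R \<mm> \<and>
     (\<exists>J :: nat \<Rightarrow> 'a set. decseq J \<and>
        (\<forall>t. irreducible_ideal R (J t) \<and> primary_to R \<mm> (J t)) \<and> cofinal_with_powers R \<mm> J)"


section \<open>Modules\<close>

definition module_hom ::
  "('a, 'r) ring_scheme \<Rightarrow> ('a, 'b) module \<Rightarrow> ('a, 'c) module \<Rightarrow> ('b \<Rightarrow> 'c) set" where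
  "module_hom R M N = {g \<in> carrier M \<rightarrow> carrier N.
     (\<forall>x \<in> carrier M. \<forall>y \<in> carrier M. g (x \<oplus>\<^bsub>M\<^esub> y) = g x \<oplus>\<^bsub>N\<^esub> g y) \<and>
     (\<forall>a \<in> carrier R. \<forall>x \<in> carrier M. g (a \<odot>\<^bsub>M\<^esub> x) = a \<odot>\<^bsub>N\<^esub> g x)}"

definition module_surj ::
  "('a, 'r) ring_scheme \<Rightarrow> ('a, 'b) module \<Rightarrow> ('a, 'c) module \<Rightarrow> ('b \<Rightarrow> 'c) set" where
  "module_surj R M P = {q \<in> module_hom R M P. q ` carrier M = carrier P}"

definition finitely_generated :: "('a, 'r) ring_scheme \<Rightarrow> ('a, 'b) module \<Rightarrow> bool" where
  "finitely_generated R M \<longleftrightarrow>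
     (\<exists>S. finite S \<and> S \<subseteq> carrier M \<and> \<Inter> {N. submodule N R M \<and> S \<subseteq> N} = carrier M)"


section \<open>Closure operations\<close>

(* A closure operation is defined on R-modules whose elements are drawn from a fixed type 'b.
   Closure under quotients is stated for arbitrary surjections, so these classes are closed
   under isomorphism within 'b.  If 'b is infinite and R embeds in it, every finitely generated
   R-module has a copy in 'b. *)
locale module_class = cring R for R :: "('a, 'r) ring_scheme" (structure) +
  fixes C :: "('a, 'b) module set"
  assumes modules: "M \<in> C \<Longrightarrow> module R M"
    and submodules: "\<lbrakk>M \<in> C; submodule N R M\<rbrakk> \<Longrightarrow> M\<lparr>carrier := N\<rparr> \<in> C"
    and quotients: "\<lbrakk>M \<in> C; module R P; q \<in> module_surj R M P\<rbrakk> \<Longrightarrow> P \<in> C"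
    and fin_gen: "\<lbrakk>module R M; finitely_generated R M\<rbrakk> \<Longrightarrow> M \<in> C"

(* cl M L is the closure of L in M. *)
locale closure_operation = module_class R C
  for R :: "('a, 'r) ring_scheme" (structure) and C :: "('a, 'b) module set" +
  fixes cl :: "('a, 'b) module \<Rightarrow> 'b set \<Rightarrow> 'b set"
  assumes cl_submodule: "\<lbrakk>M \<in> C; submodule L R M\<rbrakk> \<Longrightarrow> submodule (cl M L) R M"
    and cl_extensive: "\<lbrakk>M \<in> C; submodule L R M\<rbrakk> \<Longrightarrow> L \<subseteq> cl M L"
    and cl_idem: "\<lbrakk>M \<in> C; submodule L R M\<rbrakk> \<Longrightarrow> cl M (cl M L) = cl M L"
    and cl_mono: "\<lbrakk>M \<in> C; submodule L R M; submodule N R M; L \<subseteq> N\<rbrakk> \<Longrightarrow> cl M L \<subseteq> cl M N"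

definition residual ::
  "('a, 'r) ring_scheme \<Rightarrow> ('a, 'b) module set \<Rightarrow> (('a, 'b) module \<Rightarrow> 'b set \<Rightarrow> 'b set) \<Rightarrow> bool" where
  "residual R C cl \<longleftrightarrow>
     (\<forall>M \<in> C. \<forall>P \<in> C. \<forall>q \<in> module_surj R M P.
        cl M {x \<in> carrier M. q x = \<zero>\<^bsub>P\<^esub>} = {x \<in> carrier M. q x \<in> cl P {\<zero>\<^bsub>P\<^esub>}})"

definition functorial ::
  "('a, 'r) ring_scheme \<Rightarrow> ('a, 'b) module set \<Rightarrow> (('a, 'b) module \<Rightarrow> 'b set \<Rightarrow> 'b set) \<Rightarrow> bool" where
  "functorial R C cl \<longleftrightarrow>
     (\<forall>M \<in> C. \<forall>N \<in> C. \<forall>g \<in> module_hom R M N. \<forall>L. submodule L R M \<longrightarrow>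
        g ` cl M L \<subseteq> cl N (g ` L))"

(* R as a module over itself, carried into the type 'b along an injection \<iota>; taking 'b = 'a and
   \<iota> = id gives R itself.  The mult and one fields are not part of the module structure. *)
definition regular_module :: "('a, 'r) ring_scheme \<Rightarrow> ('a \<Rightarrow> 'b) \<Rightarrow> ('a, 'b) module" where
  "regular_module R \<iota> = (let \<rho> = inv_into (carrier R) \<iota> in
     \<lparr>carrier = \<iota> ` carrier R,
      monoid.mult = (\<lambda>x y. \<iota> (\<rho> x \<otimes>\<^bsub>R\<^esub> \<rho> y)), one = \<iota> \<one>\<^bsub>R\<^esub>,
      zero = \<iota> \<zero>\<^bsub>R\<^esub>, add = (\<lambda>x y. \<iota> (\<rho> x \<oplus>\<^bsub>R\<^esub> \<rho> y)),
      smult = (\<lambda>a x. \<iota> (a \<otimes>\<^bsub>R\<^esub> \<rho> x))\<rparr>)"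

(* The closure of the ideal I in R, computed in the copy of R; for a functorial closure it does
   not depend on \<iota>. *)
definition ideal_closure ::
  "('a, 'r) ring_scheme \<Rightarrow> ('a \<Rightarrow> 'b) \<Rightarrow> (('a, 'b) module \<Rightarrow> 'b set \<Rightarrow> 'b set) \<Rightarrow> 'a set \<Rightarrow> 'a set" where
  "ideal_closure R \<iota> cl I = {a \<in> carrier R. \<iota> a \<in> cl (regular_module R \<iota>) (\<iota> ` I)}"

end

theory Submission
  imports Defs
begin

text \<open>Suppose \<open>u \<noteq> 0\<close> lies in the closure of zero in the finitely generated module
  \<open>M\<close>. A submodule \<open>N\<close> maximal among those avoiding \<open>u\<close> contains \<open>\<mm>\<^sup>n M\<close> for some \<open>n\<close>
  (this replaces Krull's intersection theorem), hence \<open>J t M\<close> for some \<open>t\<close>. As \<open>J t\<close> is irreducible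
  and contains a power of \<open>\<mm>\<close>, the ring \<open>R/J t\<close> has a simple socle and is injective over itself, so
  the map from \<open>N + R u\<close> to \<open>R/J t\<close> that kills \<open>N\<close> and sends \<open>u\<close> to the socle extends to \<open>M\<close>.
  By functoriality the nonzero image of \<open>u\<close> lies in the closure of zero in \<open>R/J t\<close>, but that closure
  is zero because the closure is residual and \<open>J t\<close> is closed. The statement on an ideal \<open>I\<close> follows
  by applying this to \<open>R/I\<close> and residuality.\<close>

section \<open>Ideals of Noetherian local rings\<close>

text \<open>The crux is the injectivity of \<open>R / J t\<close> over itself. In place of Matlis
  duality or a theory of length, the proof uses the duality that sends an ideal \<open>A\<close> to
  the colon ideal \<open>J t : A\<close>. As the socle is simple, a chain of ideals whose successive
  quotients are at most one-dimensional over the residue field is turned into another such chain. A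
  shortest chain from \<open>J t\<close> to \<open>R\<close> thus goes to one just as long, hence
  without repetitions; this stands in for the Jordan-Hoelder theorem. Each strict inclusion supplies
  the element by which Baer's criterion corrects a map. Every submodule strictly above
  \<open>N\<close> contains \<open>u\<close>. This makes each element of \<open>\<mm>\<close> act
  nilpotently on each element of \<open>M / N\<close>, and Noetherianity turns that into a single
  power of \<open>\<mm>\<close>. Closures are defined only on modules with elements in one fixed
  type, so \<open>R / J t\<close> is realized on coset representatives inside the copy of
  \<open>R\<close>.\<close>

lemma (in cring) ideal_criterion:
  assumes "A \<subseteq> carrier R" "\<zero> \<in> A" "\<And>x y. x \<in> A \<Longrightarrow> y \<in> A \<Longrightarrow> x \<oplus> y \<in> A"
    and mult: "\<And>r x. r \<in> carrier R \<Longrightarrow> x \<in> A \<Longrightarrow> r \<otimes> x \<in> A"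
  shows "ideal A R"
proof (rule idealI)
  show "subgroup A (add_monoid R)"
  proof (rule add.subgroupI)
    fix x assume "x \<in> A"
    then have "\<ominus> x = (\<ominus> \<one>) \<otimes> x" using assms(1) by (auto simp: l_minus)
    then show "\<ominus> x \<in> A"
      using mult[of "\<ominus> \<one>" x] \<open>x \<in> A\<close> by simp
  qed (use assms in auto)
  show "r \<otimes> x \<in> A" "x \<otimes> r \<in> A" if "x \<in> A" "r \<in> carrier R" for r x
    using that mult[of r x] assms(1) m_comm[of r x] by auto
qed (rule ring_axioms)

lemma (in cring) mem_add_cgenideal:
  "z \<in> A <+>\<^bsub>R\<^esub> PIdl a \<longleftrightarrow> (\<exists>x\<in>A. \<exists>r\<in>carrier R. z = x \<oplus> r \<otimes> a)"
  unfolding set_add_def' cgenideal_def by blast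

lemma (in cring) add_cgenideal_upper:
  assumes "ideal A R" "a \<in> carrier R"
  shows "ideal (A <+>\<^bsub>R\<^esub> PIdl a) R" "A \<subseteq> A <+>\<^bsub>R\<^esub> PIdl a" "a \<in> A <+>\<^bsub>R\<^esub> PIdl a"
proof -
  interpret ideal A R by fact
  show "ideal (A <+>\<^bsub>R\<^esub> PIdl a) R"
    using assms by (simp add: add_ideals cgenideal_ideal)
  show "A \<subseteq> A <+>\<^bsub>R\<^esub> PIdl a"
    unfolding mem_add_cgenideal subset_iff
    using assms(2) by (metis Icarr l_null r_zero zero_closed)
  show "a \<in> A <+>\<^bsub>R\<^esub> PIdl a"
    unfolding mem_add_cgenideal using assms(2) by (metis a_Hcarr l_one l_zero one_closed zero_closed)
qed

lemma (in cring) add_cgenideal_least: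
  assumes "ideal A R" "ideal B R" "A \<subseteq> B" "a \<in> B"
  shows "A <+>\<^bsub>R\<^esub> PIdl a \<subseteq> B"
  using assms unfolding mem_add_cgenideal subset_iff
  by (metis additive_subgroup.a_closed ideal.axioms(1) ideal.I_l_closed)

text \<open>By Noetherianity a nonempty chain of ideals contains its own union, so Zorn's lemma
  applies to any nonempty family, closed under unions or not.\<close>

lemma (in noetherian_ring) maximal_ideal_in_family:
  assumes "\<F> \<subseteq> {I. ideal I R}" "\<F> \<noteq> {}"
  obtains P where "P \<in> \<F>" "\<And>I. I \<in> \<F> \<Longrightarrow> P \<subseteq> I \<Longrightarrow> I = P"
proof -
  have "\<exists>P\<in>\<F>. \<forall>I\<in>\<F>. P \<subseteq> I \<longrightarrow> I = P"
  proof (rule subset_Zorn)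
    fix C assume C: "subset.chain \<F> C"
    show "\<exists>U\<in>\<F>. \<forall>X\<in>C. X \<subseteq> U"
    proof (cases "C = {}")
      case True
      then show ?thesis using assms(2) by auto
    next
      case False
      moreover have "subset.chain {I. ideal I R} C"
        using C assms(1) unfolding pred_on.chain_def by auto
      ultimately have "\<Union>C \<in> C" by (rule ideal_chain_is_trivial)
      then show ?thesis using C unfolding pred_on.chain_def by auto
    qed
  qed
  then show thesis using that by blast
qed

section \<open>Powers of ideals\<close>

lemma ideals_set_simps [simp]:
  "\<one>\<^bsub>ideals_set R\<^esub> = carrier R"
  "I \<otimes>\<^bsub>ideals_set R\<^esub> J = I \<cdot>\<^bsub>R\<^esub> J"
  unfolding ideals_set_def by simp_all

lemma (in cring) ideal_ideal_power: "ideal I R \<Longrightarrow> ideal (ideal_power R I n) R"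
  by (induct n) (simp_all add: oneideal ideal_prod_is_ideal)

lemma (in cring) ideal_power_add:
  assumes "ideal I R"
  shows "ideal_power R I (m + n) = ideal_power R I m \<cdot> ideal_power R I n"
proof -
  interpret I: comm_monoid "ideals_set R" by (rule ideals_set_is_comm_monoid)
  have "I \<in> carrier (ideals_set R)" using assms by (simp add: ideals_set_def)
  from I.nat_pow_mult[OF this, of m n] show ?thesis by (simp add: ideals_set_def)
qed

lemma (in cring) ideal_power_antimono:
  assumes "ideal I R" "m \<le> n"
  shows "ideal_power R I n \<subseteq> ideal_power R I m"
  using assms(2)
  by (induct rule: dec_induct)
    (use ideal_prod_inter[OF ideal_ideal_power[OF assms(1)] assms(1)] in auto)

lemma (in cring) ideal_prod_least:
  assumes "ideal C R" "\<And>a b. a \<in> A \<Longrightarrow> b \<in> B \<Longrightarrow> a \<otimes> b \<in> C"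
  shows "A \<cdot> B \<subseteq> C"
proof
  fix z assume "z \<in> A \<cdot> B"
  then show "z \<in> C"
    by induct (use assms in \<open>auto intro: additive_subgroup.a_closed ideal.axioms(1)\<close>)
qed

text \<open>An ideal \<open>P\<close> maximal among those that contain \<open>A\<close> but no power
  of \<open>I\<close> would contain every \<open>a\<close> in \<open>I\<close>, hence
  \<open>I\<close> itself. This Noetherian induction avoids choosing generators of \<open>I\<close>
  and counting exponents.\<close>

lemma (in cring) ideal_power_subset_if_subset_radical:
  assumes "noetherian_ring R" "ideal I R" "ideal A R" "I \<subseteq> radical R A"
  obtains n where "ideal_power R I n \<subseteq> A"
proof (rule ccontr)
  assume "\<not> thesis"
  define \<F> where "\<F> = {P. ideal P R \<and> A \<subseteq> P \<and> (\<forall>n. \<not> ideal_power R I n \<subseteq> P)}"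
  have "A \<in> \<F>" using \<open>\<not> thesis\<close> that assms(3) by (auto simp: \<F>_def)
  then obtain P where P: "P \<in> \<F>" and max: "\<And>B. B \<in> \<F> \<Longrightarrow> P \<subseteq> B \<Longrightarrow> B = P"
    using noetherian_ring.maximal_ideal_in_family[OF assms(1), of \<F>] unfolding \<F>_def by blast
  interpret P: ideal P R using P by (simp add: \<F>_def)
  have "I \<subseteq> P"
  proof
    fix a assume a: "a \<in> I"
    then obtain n :: nat where ac: "a \<in> carrier R" and n: "a [^] n \<in> P"
      using assms(4) P unfolding radical_def \<F>_def by blast
    show "a \<in> P"
    proof (rule ccontr)
      assume "a \<notin> P"
      then have "P <+>\<^bsub>R\<^esub> PIdl a \<notin> \<F>"
        using max add_cgenideal_upper[OF P.is_ideal ac] by auto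
      then obtain k where k: "ideal_power R I k \<subseteq> P <+>\<^bsub>R\<^esub> PIdl a"
        using add_cgenideal_upper[OF P.is_ideal ac] P unfolding \<F>_def by blast
      \<comment> \<open>A product of \<open>i\<close> factors from \<open>P + (a)\<close> lies in
        \<open>P + (a^i)\<close>. At \<open>i = n\<close> the power of \<open>a\<close> is in
        \<open>P\<close>, so \<open>P\<close> would contain a power of \<open>I\<close>.\<close>
      have "ideal_power R I (i * k) \<subseteq> P <+>\<^bsub>R\<^esub> PIdl (a [^] i)" for i
      proof (induct i)
        case 0
        have "\<one> \<in> P <+>\<^bsub>R\<^esub> PIdl \<one>" by (rule add_cgenideal_upper) (auto simp: P.is_ideal)
        then show ?case
          by simp (metis P.is_ideal add_cgenideal_upper(1) ideal.one_imp_carrier one_closed order_refl)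
      next
        case (Suc i)
        have "ideal_power R I (i * k) \<cdot> ideal_power R I k \<subseteq> P <+>\<^bsub>R\<^esub> PIdl (a [^] Suc i)"
        proof (rule ideal_prod_least)
          show "ideal (P <+>\<^bsub>R\<^esub> PIdl (a [^] Suc i)) R"
            using add_cgenideal_upper(1)[OF P.is_ideal] ac by simp
          fix x y assume "x \<in> ideal_power R I (i * k)" "y \<in> ideal_power R I k"
          then have "x \<in> P <+>\<^bsub>R\<^esub> PIdl (a [^] i)" "y \<in> P <+>\<^bsub>R\<^esub> PIdl a" using Suc k by auto
          then obtain p r p' r' where pr: "p \<in> P" "p' \<in> P" "r \<in> carrier R" "r' \<in> carrier R"
            and xy: "x = p \<oplus> r \<otimes> a [^] i" "y = p' \<oplus> r' \<otimes> a"
            unfolding mem_add_cgenideal by auto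
          note c = P.Icarr[OF pr(1)] P.Icarr[OF pr(2)] pr(3,4) ac
          have "x \<otimes> y = (p \<otimes> y \<oplus> (r \<otimes> a [^] i) \<otimes> p') \<oplus> (r \<otimes> r') \<otimes> a [^] Suc i"
            using c by (simp add: xy l_distr r_distr m_ac a_ac)
          moreover have "p \<otimes> y \<oplus> (r \<otimes> a [^] i) \<otimes> p' \<in> P"
            using pr c xy by (simp add: P.I_l_closed P.I_r_closed)
          ultimately show "x \<otimes> y \<in> P <+>\<^bsub>R\<^esub> PIdl (a [^] Suc i)"
            unfolding mem_add_cgenideal using c by blast
        qed
        then show ?case
          using ideal_power_add[OF assms(2), of "i * k" k] by (simp add: add.commute)
      qed
      moreover have "P <+>\<^bsub>R\<^esub> PIdl (a [^] n) \<subseteq> P"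
        using add_cgenideal_least[OF P.is_ideal P.is_ideal _ n] by simp
      ultimately show False using P unfolding \<F>_def by blast
    qed
  qed
  moreover have "ideal_power R I 1 \<subseteq> I"
    using ideal_prod_inter[OF oneideal assms(2)] by simp
  ultimately show False using P unfolding \<F>_def by blast
qed

section \<open>Units and socle elements in the local ring\<close>

context noetherian_local_ring
begin

lemma maximal_ideal: "ideal \<mm> R"
  using maximal by (rule maximalideal.axioms(1))

lemma one_notin_maximal: "\<one> \<notin> \<mm>"
  using maximalideal.I_notcarr[OF maximal] ideal.one_imp_carrier[OF maximal_ideal] by auto

text \<open>Without an inverse of \<open>a\<close>, an ideal maximal among those that contain
  \<open>a\<close> but not \<open>\<one>\<close> would exist; it is a maximal ideal, hence equal to
  \<open>\<mm>\<close>.\<close>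

lemma inverse_outside_maximal:
  assumes "a \<in> carrier R" "a \<notin> \<mm>"
  obtains b where "b \<in> carrier R" "b \<otimes> a = \<one>"
proof (rule ccontr)
  assume no: "\<not> thesis"
  define \<F> where "\<F> = {P. ideal P R \<and> a \<in> P \<and> \<one> \<notin> P}"
  have "PIdl a \<in> \<F>"
    using no that assms(1) cgenideal_ideal cgenideal_self unfolding \<F>_def cgenideal_def by force
  then obtain P where P: "P \<in> \<F>" and max: "\<And>B. B \<in> \<F> \<Longrightarrow> P \<subseteq> B \<Longrightarrow> B = P"
    using maximal_ideal_in_family[of \<F>] unfolding \<F>_def by blast
  have "maximalideal P R"
  proof (rule maximalidealI)
    show "ideal P R" using P by (simp add: \<F>_def)
    show "carrier R \<noteq> P" using P by (auto simp: \<F>_def)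
    show "B = P \<or> B = carrier R" if "ideal B R" "P \<subseteq> B" "B \<subseteq> carrier R" for B
      using that max[of B] P ideal.one_imp_carrier[of B R] by (auto simp: \<F>_def)
  qed
  then have "P = \<mm>" by (rule maximal_unique)
  then show False using P assms(2) by (simp add: \<F>_def)
qed

text \<open>For the least \<open>k\<close> such that the \<open>k\<close>-th power of
  \<open>\<mm>\<close> lies in \<open>A\<close>, any element of the preceding power outside
  \<open>A\<close> represents a nonzero socle element of \<open>R / A\<close>.\<close>

lemma exists_socle_element:
  assumes "ideal A R" "\<one> \<notin> A" "ideal_power R \<mm> n \<subseteq> A"
  obtains b where "b \<in> carrier R" "b \<notin> A" "\<And>a. a \<in> \<mm> \<Longrightarrow> a \<otimes> b \<in> A"
proof -
  define k where "k = (LEAST n. ideal_power R \<mm> n \<subseteq> A)"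
  have k: "ideal_power R \<mm> k \<subseteq> A" unfolding k_def using assms(3) by (rule LeastI)
  with assms(2) have "k \<noteq> 0" by (cases k) auto
  then obtain j where j: "k = Suc j" using not0_implies_Suc by auto
  have "\<not> ideal_power R \<mm> j \<subseteq> A" 
    using not_less_Least[of j "\<lambda>n. ideal_power R \<mm> n \<subseteq> A"] unfolding k_def[symmetric] j by blast
  then obtain b where b: "b \<in> ideal_power R \<mm> j" "b \<notin> A" by auto
  show thesis
  proof
    show bc: "b \<in> carrier R" using b(1) ideal.Icarr[OF ideal_ideal_power[OF maximal_ideal]] by auto
    show "b \<notin> A" by (rule b)
    fix a assume a: "a \<in> \<mm>"
    then have "b \<otimes> a \<in> ideal_power R \<mm> k" using b(1) by (simp add: j ideal_prod.prod)
    then show "a \<otimes> b \<in> A" using k bc a ideal.Icarr[OF maximal_ideal a] by (metis m_comm subsetD)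
  qed
qed

end

section \<open>Modules\<close>

lemma (in module) submodule_criterion:
  assumes "N \<subseteq> carrier M" "\<zero>\<^bsub>M\<^esub> \<in> N"
    and "\<And>x y. x \<in> N \<Longrightarrow> y \<in> N \<Longrightarrow> x \<oplus>\<^bsub>M\<^esub> y \<in> N"
    and smult: "\<And>a x. a \<in> carrier R \<Longrightarrow> x \<in> N \<Longrightarrow> a \<odot>\<^bsub>M\<^esub> x \<in> N"
  shows "submodule N R M"
proof (rule submoduleI)
  fix x assume "x \<in> N"
  then show "\<ominus>\<^bsub>M\<^esub> x \<in> N"
    using smult[of "\<ominus> \<one>" x] assms(1) by (simp add: smult_l_minus subset_iff)
qed (use assms in auto)

lemma (in module) smult_diff:
  assumes "a \<in> carrier R" "b \<in> carrier R" "x \<in> carrier M"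
  shows "(a \<ominus> b) \<odot>\<^bsub>M\<^esub> x = a \<odot>\<^bsub>M\<^esub> x \<ominus>\<^bsub>M\<^esub> b \<odot>\<^bsub>M\<^esub> x"
  using assms by (simp add: R.minus_eq M.minus_eq smult_l_distr smult_l_minus)

lemma (in module) smult_swap:
  assumes "a \<in> carrier R" "b \<in> carrier R" "x \<in> carrier M"
  shows "a \<odot>\<^bsub>M\<^esub> (b \<odot>\<^bsub>M\<^esub> x) = b \<odot>\<^bsub>M\<^esub> (a \<odot>\<^bsub>M\<^esub> x)"
  using assms by (metis R.m_comm smult_assoc1)

lemma (in module) submodule_zero:
  assumes "submodule N R M"
  shows "\<zero>\<^bsub>M\<^esub> \<in> N"
  using submoduleE[OF assms] by (metis M.r_neg all_not_in_conv subsetD)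

lemma (in module) submodule_insert:
  assumes N: "submodule N R M" and x: "x \<in> carrier M"
  defines "N' \<equiv> {y \<oplus>\<^bsub>M\<^esub> a \<odot>\<^bsub>M\<^esub> x | y a. y \<in> N \<and> a \<in> carrier R}"
  shows "submodule N' R M" "N \<subseteq> N'" "x \<in> N'"
proof -
  note NE = submoduleE[OF N]
  have Nc: "y \<in> carrier M" if "y \<in> N" for y using NE(1) that by auto
  have memI: "z \<in> N'" if "y \<in> N" "a \<in> carrier R" "z = y \<oplus>\<^bsub>M\<^esub> a \<odot>\<^bsub>M\<^esub> x" for z y a
    using that unfolding N'_def by blast
  show sub: "N \<subseteq> N'"
  proof
    fix y assume "y \<in> N"
    then show "y \<in> N'" by (rule memI[OF _ R.zero_closed]) (use \<open>y \<in> N\<close> Nc x in simp)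
  qed
  show "x \<in> N'"
    by (rule memI[OF submodule_zero[OF N] R.one_closed]) (use x in simp)
  show "submodule N' R M"
  proof (rule submodule_criterion)
    show "N' \<subseteq> carrier M" using Nc x unfolding N'_def by auto
    show "\<zero>\<^bsub>M\<^esub> \<in> N'" using sub submodule_zero[OF N] by auto
    show "z \<oplus>\<^bsub>M\<^esub> z' \<in> N'" if z: "z \<in> N'" and z': "z' \<in> N'" for z z'
    proof -
      obtain y a where y: "y \<in> N" "a \<in> carrier R" "z = y \<oplus>\<^bsub>M\<^esub> a \<odot>\<^bsub>M\<^esub> x"
        using z unfolding N'_def by blast
      obtain y' a' where y': "y' \<in> N" "a' \<in> carrier R" "z' = y' \<oplus>\<^bsub>M\<^esub> a' \<odot>\<^bsub>M\<^esub> x"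
        using z' unfolding N'_def by blast
      show ?thesis
        using NE(5)[OF y(1) y'(1)] R.a_closed[OF y(2) y'(2)]
      proof (rule memI)
        show "z \<oplus>\<^bsub>M\<^esub> z' = (y \<oplus>\<^bsub>M\<^esub> y') \<oplus>\<^bsub>M\<^esub> (a \<oplus> a') \<odot>\<^bsub>M\<^esub> x"
          unfolding y(3) y'(3) using Nc[OF y(1)] Nc[OF y'(1)] y(2) y'(2) x
          by (simp add: smult_l_distr M.a_ac)
      qed
    qed
    show "b \<odot>\<^bsub>M\<^esub> z \<in> N'" if b: "b \<in> carrier R" and z: "z \<in> N'" for b z
    proof -
      obtain y a where y: "y \<in> N" "a \<in> carrier R" "z = y \<oplus>\<^bsub>M\<^esub> a \<odot>\<^bsub>M\<^esub> x"
        using z unfolding N'_def by blast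
      show ?thesis
        using NE(4)[OF b y(1)] R.m_closed[OF b y(2)]
      proof (rule memI)
        show "b \<odot>\<^bsub>M\<^esub> z = b \<odot>\<^bsub>M\<^esub> y \<oplus>\<^bsub>M\<^esub> (b \<otimes> a) \<odot>\<^bsub>M\<^esub> x"
          unfolding y(3) using Nc[OF y(1)] y(2) x b by (simp add: smult_r_distr smult_assoc1)
      qed
    qed
  qed
qed

lemma (in module) submodule_Union_chain:
  assumes chain: "subset.chain {N. submodule N R M} \<C>" and "\<C> \<noteq> {}"
  shows "submodule (\<Union>\<C>) R M"
proof (rule submodule_criterion)
  have sub: "submodule N R M" if "N \<in> \<C>" for N
    using chain that unfolding pred_on.chain_def by auto
  show "\<Union>\<C> \<subseteq> carrier M" using submoduleE(1)[OF sub] by blast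
  show "\<zero>\<^bsub>M\<^esub> \<in> \<Union>\<C>" using submodule_zero[OF sub] \<open>\<C> \<noteq> {}\<close> by blast
  show "x \<oplus>\<^bsub>M\<^esub> y \<in> \<Union>\<C>" if xy: "x \<in> \<Union>\<C>" "y \<in> \<Union>\<C>" for x y
  proof -
    obtain N N' where N: "N \<in> \<C>" "x \<in> N" "N' \<in> \<C>" "y \<in> N'" using xy by blast
    have "N \<subseteq> N' \<or> N' \<subseteq> N" using chain N(1,3) unfolding pred_on.chain_def by auto
    then obtain K where "K \<in> \<C>" "x \<in> K" "y \<in> K" using N by blast
    then show ?thesis using submoduleE(5)[OF sub] by blast
  qed
  show "a \<odot>\<^bsub>M\<^esub> x \<in> \<Union>\<C>" if ax: "a \<in> carrier R" "x \<in> \<Union>\<C>" for a x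
    using ax submoduleE(4)[OF sub] by blast
qed

lemma (in module) zero_submodule: "submodule {\<zero>\<^bsub>M\<^esub>} R M"
  by (rule submodule_criterion) auto

lemma (in module) submodule_annihilator_ideal:
  assumes N: "submodule N R M" and x: "x \<in> carrier M"
  shows "ideal {a \<in> carrier R. a \<odot>\<^bsub>M\<^esub> x \<in> N} R"
proof (rule R.ideal_criterion)
  note NE = submoduleE[OF N]
  show "\<zero> \<in> {a \<in> carrier R. a \<odot>\<^bsub>M\<^esub> x \<in> N}"
    using x NE(2,4) by (metis (mono_tags, lifting) R.zero_closed all_not_in_conv mem_Collect_eq smult_l_null subsetD NE(1))
  show "a \<oplus> b \<in> {a \<in> carrier R. a \<odot>\<^bsub>M\<^esub> x \<in> N}"
    if "a \<in> {a \<in> carrier R. a \<odot>\<^bsub>M\<^esub> x \<in> N}" "b \<in> {a \<in> carrier R. a \<odot>\<^bsub>M\<^esub> x \<in> N}" for a b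
    using that x NE(5) by (simp add: smult_l_distr)
  show "r \<otimes> a \<in> {a \<in> carrier R. a \<odot>\<^bsub>M\<^esub> x \<in> N}"
    if "r \<in> carrier R" "a \<in> {a \<in> carrier R. a \<odot>\<^bsub>M\<^esub> x \<in> N}" for r a
    using that x NE(4) by (simp add: smult_assoc1)
qed auto

lemma module_hom_on_submodule:
  "f \<in> module_hom R (M\<lparr>carrier := L\<rparr>) Q \<longleftrightarrow> f \<in> L \<rightarrow> carrier Q \<and>
     (\<forall>x\<in>L. \<forall>y\<in>L. f (x \<oplus>\<^bsub>M\<^esub> y) = f x \<oplus>\<^bsub>Q\<^esub> f y) \<and>
     (\<forall>a\<in>carrier R. \<forall>x\<in>L. f (a \<odot>\<^bsub>M\<^esub> x) = a \<odot>\<^bsub>Q\<^esub> f x)"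
  by (simp add: module_hom_def)

text \<open>Stated for any compatible map \<open>q\<close>, injective or not, so that it serves both
  the copy of \<open>R\<close> along \<open>\<iota>\<close> and quotients, where \<open>q\<close>
  picks coset representatives.\<close>

lemma module_transport:
  fixes R (structure) and M :: "('a, 'b) module" and P :: "('a, 'c) module"
  assumes M: "module R M" and carrier: "carrier P = q ` carrier M"
    and zero: "\<zero>\<^bsub>P\<^esub> = q \<zero>\<^bsub>M\<^esub>"
    and add: "\<And>x y. x \<in> carrier M \<Longrightarrow> y \<in> carrier M \<Longrightarrow> q x \<oplus>\<^bsub>P\<^esub> q y = q (x \<oplus>\<^bsub>M\<^esub> y)"
    and smult: "\<And>a x. a \<in> carrier R \<Longrightarrow> x \<in> carrier M \<Longrightarrow> a \<odot>\<^bsub>P\<^esub> q x = q (a \<odot>\<^bsub>M\<^esub> x)"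
  shows "module R P" "q \<in> module_surj R M P"
proof -
  interpret M: module R M by (rule M)
  have "abelian_group P"
  proof (rule abelian_groupI)
    show "\<exists>y\<in>carrier P. y \<oplus>\<^bsub>P\<^esub> x = \<zero>\<^bsub>P\<^esub>" if xP: "x \<in> carrier P" for x
    proof -
      obtain x' where x': "x' \<in> carrier M" "x = q x'" using xP carrier by auto
      then have "q (\<ominus>\<^bsub>M\<^esub> x') \<oplus>\<^bsub>P\<^esub> x = \<zero>\<^bsub>P\<^esub>" by (simp add: add zero M.M.l_neg)
      then show ?thesis using x' carrier by auto
    qed
  qed (auto simp: carrier zero add M.M.a_ac)
  then show "module R P"
    by (intro moduleI M.R.is_cring)
      (auto simp: carrier add smult M.smult_l_distr M.smult_r_distr M.smult_assoc1)
  show "q \<in> module_surj R M P"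
    unfolding module_surj_def module_hom_def using carrier add smult by auto
qed

text \<open>The carrier of the quotient consists of one chosen representative per coset. So
  \<open>P\<close> has elements of the same type as \<open>M\<close>, as membership in the class of
  the closure operation demands.\<close>

lemma exists_quotient_module:
  fixes R (structure) and M :: "('a, 'b) module"
  assumes M: "module R M" and N: "submodule N R M"
  obtains P :: "('a, 'b) module" and q where "module R P" "q \<in> module_surj R M P"
    "{x \<in> carrier M. q x = \<zero>\<^bsub>P\<^esub>} = N"
proof -
  interpret M: module R M by (rule M)
  note NE = M.submoduleE[OF N]
  have diff0: "x \<ominus>\<^bsub>M\<^esub> x \<in> N" if "x \<in> carrier M" for x
    using M.submodule_zero[OF N] that by (simp add: M.M.minus_eq M.M.r_neg)
  have diff_swap: "y \<ominus>\<^bsub>M\<^esub> x \<in> N" if "x \<ominus>\<^bsub>M\<^esub> y \<in> N" "x \<in> carrier M" "y \<in> carrier M" for x y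
    using NE(3)[OF that(1)] that(2,3) by (simp add: M.M.minus_eq M.M.minus_add M.M.a_comm)
  have diff_trans: "x \<ominus>\<^bsub>M\<^esub> z \<in> N"
    if "x \<ominus>\<^bsub>M\<^esub> y \<in> N" "y \<ominus>\<^bsub>M\<^esub> z \<in> N" "x \<in> carrier M" "y \<in> carrier M" "z \<in> carrier M" for x y z
  proof -
    have "x \<ominus>\<^bsub>M\<^esub> z = (x \<ominus>\<^bsub>M\<^esub> y) \<oplus>\<^bsub>M\<^esub> (y \<ominus>\<^bsub>M\<^esub> z)"
      using that(3-) by (simp add: M.M.minus_eq M.M.a_assoc M.M.r_neg1)
    then show ?thesis using NE(5)[OF that(1,2)] by simp
  qed
  define q where "q x = (SOME y. y \<in> carrier M \<and> y \<ominus>\<^bsub>M\<^esub> x \<in> N)" for x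
  have q: "q x \<in> carrier M \<and> q x \<ominus>\<^bsub>M\<^esub> x \<in> N" if "x \<in> carrier M" for x
    unfolding q_def by (rule someI[of _ x]) (use that diff0 in auto)
  \<comment> \<open>Congruent elements define the same predicate, so the choice operator returns
    literally the same representative.\<close>
  have q_cong: "q x = q y" if "x \<ominus>\<^bsub>M\<^esub> y \<in> N" "x \<in> carrier M" "y \<in> carrier M" for x y
  proof -
    have "z \<in> carrier M \<and> z \<ominus>\<^bsub>M\<^esub> x \<in> N \<longleftrightarrow> z \<in> carrier M \<and> z \<ominus>\<^bsub>M\<^esub> y \<in> N" for z
      using diff_trans[of z x y] diff_trans[of z y x] diff_swap[OF that] that by blast
    then show ?thesis unfolding q_def by simp
  qed
  have q_eq: "q x = q y \<longleftrightarrow> x \<ominus>\<^bsub>M\<^esub> y \<in> N" if xy: "x \<in> carrier M" "y \<in> carrier M" for x y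
  proof
    assume eq: "q x = q y"
    have "x \<ominus>\<^bsub>M\<^esub> q x \<in> N" using diff_swap[of "q x" x] q[OF xy(1)] xy by blast
    then show "x \<ominus>\<^bsub>M\<^esub> y \<in> N" using diff_trans[of x "q x" y] q[OF xy(2)] xy eq by simp
  qed (rule q_cong[OF _ xy])
  define P :: "('a, 'b) module" where
    "P = \<lparr>carrier = q ` carrier M, monoid.mult = undefined, one = undefined, zero = q \<zero>\<^bsub>M\<^esub>,
      add = (\<lambda>x y. q (x \<oplus>\<^bsub>M\<^esub> y)), smult = (\<lambda>a x. q (a \<odot>\<^bsub>M\<^esub> x))\<rparr>"
  have add: "q x \<oplus>\<^bsub>P\<^esub> q y = q (x \<oplus>\<^bsub>M\<^esub> y)" if xy: "x \<in> carrier M" "y \<in> carrier M" for x y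
  proof -
    have "(q x \<oplus>\<^bsub>M\<^esub> q y) \<ominus>\<^bsub>M\<^esub> (x \<oplus>\<^bsub>M\<^esub> y) = (q x \<ominus>\<^bsub>M\<^esub> x) \<oplus>\<^bsub>M\<^esub> (q y \<ominus>\<^bsub>M\<^esub> y)"
      using q[OF xy(1)] q[OF xy(2)] xy by (simp add: M.M.minus_eq M.M.minus_add M.M.a_ac)
    also have "\<dots> \<in> N" using q[OF xy(1)] q[OF xy(2)] NE(5) by blast
    finally show ?thesis unfolding P_def using q_cong q[OF xy(1)] q[OF xy(2)] xy by simp
  qed
  have smult: "a \<odot>\<^bsub>P\<^esub> q x = q (a \<odot>\<^bsub>M\<^esub> x)" if a: "a \<in> carrier R" and x: "x \<in> carrier M" for a x
  proof -
    have "a \<odot>\<^bsub>M\<^esub> q x \<ominus>\<^bsub>M\<^esub> a \<odot>\<^bsub>M\<^esub> x = a \<odot>\<^bsub>M\<^esub> (q x \<ominus>\<^bsub>M\<^esub> x)"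
      using q[OF x] a x by (simp add: M.M.minus_eq M.smult_r_distr M.smult_r_minus)
    also have "\<dots> \<in> N" using q[OF x] NE(4)[OF a] by blast
    finally show ?thesis unfolding P_def using q_cong q[OF x] a x by simp
  qed
  have "carrier P = q ` carrier M" "\<zero>\<^bsub>P\<^esub> = q \<zero>\<^bsub>M\<^esub>" by (simp_all add: P_def)
  note t = module_transport[OF M this add smult]
  have "{x \<in> carrier M. q x = \<zero>\<^bsub>P\<^esub>} = N"
  proof -
    have "q x = q \<zero>\<^bsub>M\<^esub> \<longleftrightarrow> x \<in> N" if "x \<in> carrier M" for x
      using q_eq[OF that M.M.zero_closed] that M.M.minus_equality[of "\<zero>\<^bsub>M\<^esub>" "\<zero>\<^bsub>M\<^esub>"]
      by (simp add: M.M.minus_eq)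
    then show ?thesis using NE(1) by (auto simp: P_def)
  qed
  with t show thesis using that by blast
qed

text \<open>The copy of \<open>R\<close> and its cyclic quotients enter the class \<open>C\<close>
  through \<open>fin_gen\<close>; this provides the premise.\<close>

lemma cyclic_finitely_generated:
  assumes "module R P" and e: "e \<in> carrier P"
    and gen: "\<And>p. p \<in> carrier P \<Longrightarrow> \<exists>a\<in>carrier R. p = a \<odot>\<^bsub>P\<^esub> e"
  shows "finitely_generated R P"
proof -
  interpret P: module R P by fact
  have "\<Inter> {N. submodule N R P \<and> {e} \<subseteq> N} = carrier P"
  proof
    show "\<Inter> {N. submodule N R P \<and> {e} \<subseteq> N} \<subseteq> carrier P"
      using P.carrier_is_submodule e by auto
    show "carrier P \<subseteq> \<Inter> {N. submodule N R P \<and> {e} \<subseteq> N}"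
      using gen P.submoduleE(4) by fastforce
  qed
  then show ?thesis
    unfolding finitely_generated_def using e by (intro exI[of _ "{e}"]) simp
qed

section \<open>Self-injectivity modulo an irreducible ideal\<close>

text \<open>Abstracts \<open>R / J t\<close>, with \<open>e\<close> the class of \<open>1\<close>.
  The exponent \<open>n\<close> makes \<open>R / Ann(e)\<close> a ring of finite length, and the
  last axiom says that the socle of \<open>Q\<close> is at most one-dimensional over the residue
  field.\<close>

locale simple_socle_module = module R Q + noetherian_local_ring R \<mm>
  for R (structure) and \<mm> and Q :: "('a, 'c) module" (structure) +
  fixes e n
  assumes element_closed [simp]: "e \<in> carrier Q"
    and element_nonzero: "e \<noteq> \<zero>\<^bsub>Q\<^esub>"
    and power_annihilates: "a \<in> ideal_power R \<mm> n \<Longrightarrow> a \<odot>\<^bsub>Q\<^esub> e = \<zero>\<^bsub>Q\<^esub>"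
    and simple_socle: "\<lbrakk>p \<in> carrier Q; p' \<in> carrier Q; p \<noteq> \<zero>\<^bsub>Q\<^esub>;
      \<And>a. a \<in> \<mm> \<Longrightarrow> a \<odot>\<^bsub>Q\<^esub> p = \<zero>\<^bsub>Q\<^esub>; \<And>a. a \<in> \<mm> \<Longrightarrow> a \<odot>\<^bsub>Q\<^esub> p' = \<zero>\<^bsub>Q\<^esub>\<rbrakk>
      \<Longrightarrow> \<exists>r\<in>carrier R. p' = r \<odot>\<^bsub>Q\<^esub> p"
begin

text \<open>The colon ideal \<open>Ann(e) : A\<close>, that is, the annihilator of
  \<open>A e\<close>. In particular \<open>dual (carrier R)\<close> is
  \<open>Ann(e)\<close>.\<close>

definition dual :: "'a set \<Rightarrow> 'a set" where
  "dual A = {c \<in> carrier R. \<forall>a\<in>A. c \<odot>\<^bsub>Q\<^esub> (a \<odot>\<^bsub>Q\<^esub> e) = \<zero>\<^bsub>Q\<^esub>}"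

definition step :: "'a set \<Rightarrow> 'a set \<Rightarrow> bool" where
  "step A A' \<longleftrightarrow> ideal A R \<and>
     (\<exists>b\<in>carrier R. A' = A <+>\<^bsub>R\<^esub> PIdl b \<and> (\<forall>a\<in>\<mm>. a \<otimes> b \<in> A))"

lemma maximal_closed: "a \<in> \<mm> \<Longrightarrow> a \<in> carrier R"
  by (rule ideal.Icarr[OF maximal_ideal])

lemma dualI:
  "c \<in> carrier R \<Longrightarrow> (\<And>a. a \<in> A \<Longrightarrow> c \<odot>\<^bsub>Q\<^esub> (a \<odot>\<^bsub>Q\<^esub> e) = \<zero>\<^bsub>Q\<^esub>) \<Longrightarrow> c \<in> dual A"
  unfolding dual_def by blast

lemma dualD: "c \<in> dual A \<Longrightarrow> a \<in> A \<Longrightarrow> c \<odot>\<^bsub>Q\<^esub> (a \<odot>\<^bsub>Q\<^esub> e) = \<zero>\<^bsub>Q\<^esub>"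
  unfolding dual_def by blast

lemma ideal_dual:
  assumes "A \<subseteq> carrier R"
  shows "ideal (dual A) R"
proof (rule R.ideal_criterion)
  fix x y assume "x \<in> dual A" "y \<in> dual A"
  then show "x \<oplus> y \<in> dual A"
    using assms by (simp add: dual_def smult_l_distr subset_iff)
next
  fix x r assume "x \<in> dual A" "r \<in> carrier R"
  then show "r \<otimes> x \<in> dual A"
    using assms by (simp add: dual_def smult_assoc1 subset_iff)
qed (use assms in \<open>auto simp: dual_def subset_iff\<close>)

lemma dual_dual_carrier: "dual (dual (carrier R)) = carrier R"
proof -
  have "c \<odot>\<^bsub>Q\<^esub> (a \<odot>\<^bsub>Q\<^esub> e) = \<zero>\<^bsub>Q\<^esub>" if c: "c \<in> carrier R" and a: "a \<in> dual (carrier R)" for a c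
  proof -
    have "a \<odot>\<^bsub>Q\<^esub> (c \<odot>\<^bsub>Q\<^esub> e) = \<zero>\<^bsub>Q\<^esub>" "a \<in> carrier R" using a c unfolding dual_def by auto
    then show ?thesis using c by (metis smult_swap element_closed)
  qed
  then show ?thesis by (auto simp: dual_def[of "dual (carrier R)"])
qed

lemma step_ideal: "step A A' \<Longrightarrow> ideal A' R"
  unfolding step_def using add_cgenideal_upper(1) by auto

text \<open>The map \<open>c \<mapsto> c b e\<close> sends \<open>dual A\<close> into the socle of
  \<open>Q\<close> with kernel \<open>dual A'\<close>, and this socle is at most
  one-dimensional.\<close>

lemma dual_step:
  assumes "step A A'"
  shows "step (dual A') (dual A)"
proof -
  obtain b where A: "ideal A R" and b: "b \<in> carrier R" and A': "A' = A <+>\<^bsub>R\<^esub> PIdl b"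
    and mb: "\<And>a. a \<in> \<mm> \<Longrightarrow> a \<otimes> b \<in> A"
    using assms unfolding step_def by blast
  interpret A: ideal A R by (rule A)
  interpret A': ideal A' R using assms by (rule step_ideal)
  have dualA: "ideal (dual A) R" by (rule ideal_dual) auto
  have dualA': "ideal (dual A') R" by (rule ideal_dual) auto
  interpret dA: ideal "dual A" R by (rule dualA)
  have sub: "dual A' \<subseteq> dual A"
    using add_cgenideal_upper(2)[OF A b] unfolding dual_def A' by blast
  have mem: "c \<in> dual A' \<longleftrightarrow> c \<odot>\<^bsub>Q\<^esub> (b \<odot>\<^bsub>Q\<^esub> e) = \<zero>\<^bsub>Q\<^esub>" if c: "c \<in> dual A" for c
  proof
    assume "c \<in> dual A'"
    then show "c \<odot>\<^bsub>Q\<^esub> (b \<odot>\<^bsub>Q\<^esub> e) = \<zero>\<^bsub>Q\<^esub>"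
      using add_cgenideal_upper(3)[OF A b] unfolding dual_def A' by blast
  next
    assume 0: "c \<odot>\<^bsub>Q\<^esub> (b \<odot>\<^bsub>Q\<^esub> e) = \<zero>\<^bsub>Q\<^esub>"
    have cc: "c \<in> carrier R" using c by (rule dA.Icarr)
    have "c \<odot>\<^bsub>Q\<^esub> (a \<odot>\<^bsub>Q\<^esub> e) = \<zero>\<^bsub>Q\<^esub>" if aA': "a \<in> A'" for a
    proof -
      obtain x r where x: "x \<in> A" and r: "r \<in> carrier R" and a: "a = x \<oplus> r \<otimes> b"
        using aA' unfolding A' mem_add_cgenideal by blast
      have "c \<odot>\<^bsub>Q\<^esub> (x \<odot>\<^bsub>Q\<^esub> e) = \<zero>\<^bsub>Q\<^esub>" using c x by (rule dualD)
      then show ?thesis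
        unfolding a using r cc b A.Icarr[OF x] 0
        by (simp add: smult_l_distr smult_r_distr smult_assoc1 smult_swap[of c r])
    qed
    with cc show "c \<in> dual A'" by (rule dualI)
  qed
  have socle: "a \<odot>\<^bsub>Q\<^esub> (c \<odot>\<^bsub>Q\<^esub> (b \<odot>\<^bsub>Q\<^esub> e)) = \<zero>\<^bsub>Q\<^esub>" if c: "c \<in> dual A" and a: "a \<in> \<mm>" for c a
  proof -
    have "c \<odot>\<^bsub>Q\<^esub> ((a \<otimes> b) \<odot>\<^bsub>Q\<^esub> e) = \<zero>\<^bsub>Q\<^esub>" using c mb[OF a] by (rule dualD)
    then show ?thesis
      using dA.Icarr[OF c] maximal_closed[OF a] b by (simp add: smult_assoc1 smult_swap[of c a])
  qed
  have "\<exists>c\<in>carrier R. dual A = dual A' <+>\<^bsub>R\<^esub> PIdl c \<and> (\<forall>a\<in>\<mm>. a \<otimes> c \<in> dual A')"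
  proof (cases "dual A \<subseteq> dual A'")
    case True
    with sub have eq: "dual A = dual A'" by auto
    \<comment> \<open>When the duals coincide, the step is a repetition and \<open>\<zero>\<close>
      serves as its generator.\<close>
    have "dual A = dual A' <+>\<^bsub>R\<^esub> PIdl \<zero>"
      using add_cgenideal_upper(2)[OF dualA' R.zero_closed]
        add_cgenideal_least[OF dualA' dualA sub dA.zero_closed] eq by auto
    moreover have "\<forall>a\<in>\<mm>. a \<otimes> \<zero> \<in> dual A'"
      using dA.zero_closed maximal_closed eq by auto
    ultimately show ?thesis by blast
  next
    case False
    then obtain c where c: "c \<in> dual A" "c \<notin> dual A'" by auto
    then have nz: "c \<odot>\<^bsub>Q\<^esub> (b \<odot>\<^bsub>Q\<^esub> e) \<noteq> \<zero>\<^bsub>Q\<^esub>" using mem by blast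
    have cc: "c \<in> carrier R" using c(1) by (rule dA.Icarr)
    have "dual A \<subseteq> dual A' <+>\<^bsub>R\<^esub> PIdl c"
    proof
      fix d assume d: "d \<in> dual A"
      have dc: "d \<in> carrier R" using d by (rule dA.Icarr)
      \<comment> \<open>The socle element \<open>d b e\<close> is a multiple of the nonzero one
        \<open>c b e\<close>. Subtracting that multiple of \<open>c\<close> from \<open>d\<close>
        leaves an element that annihilates \<open>b e\<close>, hence lies in
        \<open>dual A'\<close>.\<close>
      obtain r where r: "r \<in> carrier R"
        and eq: "d \<odot>\<^bsub>Q\<^esub> (b \<odot>\<^bsub>Q\<^esub> e) = r \<odot>\<^bsub>Q\<^esub> (c \<odot>\<^bsub>Q\<^esub> (b \<odot>\<^bsub>Q\<^esub> e))"
        using simple_socle[OF _ _ nz socle[OF c(1)] socle[OF d]] cc dc b by auto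
      have rc: "r \<otimes> c \<in> dual A" using c(1) r by (rule dA.I_l_closed)
      then have dd: "d \<ominus> r \<otimes> c \<in> dual A"
        using d by (simp add: R.minus_eq)
      then have "d \<ominus> r \<otimes> c \<in> dual A'"
        unfolding mem[OF dd] using eq r cc dc b by (simp add: smult_diff smult_assoc1 M.minus_eq M.r_neg)
      moreover have "d = (d \<ominus> r \<otimes> c) \<oplus> r \<otimes> c"
        using r cc dc by (simp add: R.minus_eq R.a_assoc R.l_neg)
      ultimately show "d \<in> dual A' <+>\<^bsub>R\<^esub> PIdl c"
        unfolding mem_add_cgenideal using r by blast
    qed
    moreover have "dual A' <+>\<^bsub>R\<^esub> PIdl c \<subseteq> dual A"
      using dualA' dualA sub c(1) by (rule add_cgenideal_least)
    moreover have "a \<otimes> c \<in> dual A'" if a: "a \<in> \<mm>" for a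
      using mem[OF dA.I_l_closed[OF c(1) maximal_closed[OF a]]] socle[OF c(1) a]
        maximal_closed[OF a] cc b by (simp add: smult_assoc1)
    ultimately show ?thesis using cc by blast
  qed
  then show ?thesis unfolding step_def using dualA' by blast
qed

lemma dual_steps: "(step ^^ k) A A' \<Longrightarrow> (step ^^ k) (dual A') (dual A)"
proof (induct k arbitrary: A')
  case (Suc k)
  then obtain B where "(step ^^ k) A B" "step B A'" by auto
  with Suc(1) show ?case using relpowp_Suc_I2 dual_step by metis
qed auto

text \<open>An ideal maximal among those reachable from \<open>Ann(e)\<close> contains the
  \<open>n\<close>-th power of \<open>\<mm>\<close>; if it were proper, a socle element modulo it
  would give one more step.\<close>

lemma exists_steps: "\<exists>k. (step ^^ k) (dual (carrier R)) (carrier R)"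
proof -
  define \<F> where "\<F> = {A. ideal A R \<and> step\<^sup>*\<^sup>* (dual (carrier R)) A}"
  have "dual (carrier R) \<in> \<F>" by (simp add: \<F>_def ideal_dual)
  then obtain A where A: "A \<in> \<F>" and max: "\<And>B. B \<in> \<F> \<Longrightarrow> A \<subseteq> B \<Longrightarrow> B = A"
    using maximal_ideal_in_family[of \<F>] unfolding \<F>_def by blast
  have mono: "B \<subseteq> B'" if "step B B'" for B B'
    using that add_cgenideal_upper(2) unfolding step_def by auto
  have "dual (carrier R) \<subseteq> A"
  proof -
    have "step\<^sup>*\<^sup>* (dual (carrier R)) A" using A by (simp add: \<F>_def)
    then show ?thesis by induct (use mono in auto)
  qed
  moreover have "ideal_power R \<mm> n \<subseteq> dual (carrier R)"
  proof
    fix a assume a: "a \<in> ideal_power R \<mm> n"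
    then have "a \<in> carrier R" using ideal.Icarr[OF ideal_ideal_power[OF maximal_ideal]] by blast
    then show "a \<in> dual (carrier R)"
      unfolding dual_def using power_annihilates[OF a] by (auto simp: smult_swap[of a])
  qed
  ultimately have pow: "ideal_power R \<mm> n \<subseteq> A" by auto
  have idA: "ideal A R" using A by (simp add: \<F>_def)
  have "\<one> \<in> A"
  proof (rule ccontr)
    assume "\<one> \<notin> A"
    then obtain b where b: "b \<in> carrier R" "b \<notin> A" "\<And>a. a \<in> \<mm> \<Longrightarrow> a \<otimes> b \<in> A"
      using exists_socle_element[OF idA _ pow] by blast
    have "step A (A <+>\<^bsub>R\<^esub> PIdl b)" unfolding step_def using idA b by blast
    then have "A <+>\<^bsub>R\<^esub> PIdl b \<in> \<F>" using A step_ideal unfolding \<F>_def by auto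
    then show False using max add_cgenideal_upper[OF idA b(1)] b(2) by blast
  qed
  then have "A = carrier R" by (rule ideal.one_imp_carrier[OF idA])
  then show ?thesis using A unfolding \<F>_def by (auto simp: rtranclp_power)
qed

text \<open>Along a composition series of minimal length the duals strictly decrease: the dual series is
  again a series of the same length from the annihilator of \<^term>\<open>e\<close> to \<^term>\<open>R\<close>, so a repetition
  in it could be cut out.\<close>

lemma exists_strictly_dualized_series:
  "\<exists>B l. B 0 = dual (carrier R) \<and> B l = carrier R \<and>
    (\<forall>i<l. step (B i) (B (Suc i)) \<and> dual (B i) \<noteq> dual (B (Suc i)))"
proof -
  let ?P = "\<lambda>k. (step ^^ k) (dual (carrier R)) (carrier R)"
  define l where "l = (LEAST k. ?P k)"
  have "?P l" unfolding l_def using exists_steps by (rule LeastI_ex)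
  then obtain B where B: "B 0 = dual (carrier R)" "B l = carrier R"
      "\<And>i. i < l \<Longrightarrow> step (B i) (B (Suc i))"
    unfolding relpowp_fun_conv by blast
  moreover have "dual (B i) \<noteq> dual (B (Suc i))" if i: "i < l" for i
  proof
    assume eq: "dual (B i) = dual (B (Suc i))"
    have "(step ^^ i) (B 0) (B i)"
      unfolding relpowp_fun_conv using B(3) i by (intro exI[of _ B]) auto
    then have 1: "(step ^^ i) (dual (B i)) (carrier R)"
      using dual_steps B(1) dual_dual_carrier by metis
    have "(step ^^ (l - Suc i)) (B (Suc i)) (B l)"
      unfolding relpowp_fun_conv using B(3) i by (intro exI[of _ "\<lambda>j. B (Suc i + j)"]) auto
    then have "(step ^^ (l - Suc i)) (dual (carrier R)) (dual (B (Suc i)))"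
      using dual_steps B(2) by metis
    with 1 eq have "?P ((l - Suc i) + i)" by (auto simp: relpowp_add)
    moreover have "(l - Suc i) + i < l" using i by auto
    ultimately show False using not_less_Least unfolding l_def by blast
  qed
  ultimately show ?thesis by blast
qed

text \<open>Baer's criterion for the injectivity of \<^term>\<open>Q\<close> over \<^term>\<open>R\<close> modulo the annihilator
  of \<^term>\<open>e\<close>. Climbing up a composition series, \<^term>\<open>f\<close> is corrected on one new element
  at a time; its value there lies in the socle.\<close>

lemma baer_criterion:
  assumes A: "ideal A R" and f_closed: "\<And>a. a \<in> A \<Longrightarrow> f a \<in> carrier Q"
    and f_add: "\<And>a b. a \<in> A \<Longrightarrow> b \<in> A \<Longrightarrow> f (a \<oplus> b) = f a \<oplus>\<^bsub>Q\<^esub> f b"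
    and f_mult: "\<And>r a. r \<in> carrier R \<Longrightarrow> a \<in> A \<Longrightarrow> f (r \<otimes> a) = r \<odot>\<^bsub>Q\<^esub> f a"
    and f_zero: "\<And>a. a \<in> A \<Longrightarrow> a \<odot>\<^bsub>Q\<^esub> e = \<zero>\<^bsub>Q\<^esub> \<Longrightarrow> f a = \<zero>\<^bsub>Q\<^esub>"
  obtains q where "q \<in> carrier Q" "\<And>a. a \<in> A \<Longrightarrow> f a = a \<odot>\<^bsub>Q\<^esub> q"
proof -
  interpret A: ideal A R by (rule A)
  obtain B l where B0: "B 0 = dual (carrier R)" and Bl: "B l = carrier R"
    and st: "\<And>i. i < l \<Longrightarrow> step (B i) (B (Suc i))"
    and strict: "\<And>i. i < l \<Longrightarrow> dual (B i) \<noteq> dual (B (Suc i))"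
    using exists_strictly_dualized_series by blast
  have "\<exists>q\<in>carrier Q. \<forall>a\<in>A \<inter> B i. f a = a \<odot>\<^bsub>Q\<^esub> q" if "i \<le> l" for i
    using that
  proof (induct i)
    case 0
    \<comment> \<open>The series starts at \<open>Ann(e)\<close>, where \<open>f\<close> vanishes by
      \<open>f_zero\<close>, so zero is a correct first value of \<open>q\<close>.\<close>
    have "f a = a \<odot>\<^bsub>Q\<^esub> \<zero>\<^bsub>Q\<^esub>" if "a \<in> A" "a \<in> dual (carrier R)" for a
    proof -
      have "a \<odot>\<^bsub>Q\<^esub> (\<one> \<odot>\<^bsub>Q\<^esub> e) = \<zero>\<^bsub>Q\<^esub>" using that(2) unfolding dual_def by blast
      then show ?thesis using f_zero[OF that(1)] A.Icarr[OF that(1)] by simp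
    qed
    then show ?case using B0 by (intro bexI[of _ "\<zero>\<^bsub>Q\<^esub>"]) auto
  next
    case (Suc i)
    then obtain q where q: "q \<in> carrier Q" and fq: "\<And>a. a \<in> A \<Longrightarrow> a \<in> B i \<Longrightarrow> f a = a \<odot>\<^bsub>Q\<^esub> q"
      by auto
    have stp: "step (B i) (B (Suc i))" using st Suc(2) by auto
    then obtain b where Bi: "ideal (B i) R" and b: "b \<in> carrier R"
      and BS: "B (Suc i) = B i <+>\<^bsub>R\<^esub> PIdl b" and mb: "\<And>a. a \<in> \<mm> \<Longrightarrow> a \<otimes> b \<in> B i"
      unfolding step_def by blast
    interpret Bi: ideal "B i" R by (rule Bi)
    show ?case
    proof (cases "A \<inter> B (Suc i) \<subseteq> B i")
      case True
      then show ?thesis using q fq by blast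
    next
      case False
      then obtain a0 where a0: "a0 \<in> A" "a0 \<in> B (Suc i)" "a0 \<notin> B i" by auto
      then obtain x r where x: "x \<in> B i" and r: "r \<in> carrier R" and a0_eq: "a0 = x \<oplus> r \<otimes> b"
        unfolding BS mem_add_cgenideal by auto
      have a0c: "a0 \<in> carrier R" using a0(1) by (rule A.Icarr)
      have xc: "x \<in> carrier R" using x by (rule Bi.Icarr)
      \<comment> \<open>If \<open>r\<close> were in \<open>\<mm>\<close>, then \<open>r b\<close>,
        and with it \<open>a0\<close>, would lie in \<open>B i\<close>. Hence \<open>r\<close> is a
        unit, and \<open>a0\<close>, which lies in \<open>A\<close>, can replace \<open>b\<close> as
        the new generator.\<close>
      have "r \<notin> \<mm>" using a0(3) a0_eq x mb[of r] by auto
      then obtain s where s: "s \<in> carrier R" "s \<otimes> r = \<one>"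
        using inverse_outside_maximal r by blast
      have b_eq: "b = s \<otimes> (a0 \<ominus> x)"
      proof -
        have "a0 \<ominus> x = r \<otimes> b"
          using xc r b unfolding a0_eq by (simp add: R.minus_eq R.a_ac R.r_neg2)
        then show ?thesis using s r b by (simp flip: R.m_assoc)
      qed
      have ma0: "a \<otimes> a0 \<in> B i" if a: "a \<in> \<mm>" for a
      proof -
        have ac: "a \<in> carrier R" using a by (rule maximal_closed)
        have "a \<otimes> a0 = a \<otimes> x \<oplus> r \<otimes> (a \<otimes> b)"
          using ac xc r b unfolding a0_eq by (simp add: R.r_distr R.m_lcomm)
        then show ?thesis using mb[OF a] x r ac by (simp add: Bi.I_l_closed)
      qed
      have "dual (B (Suc i)) \<subseteq> dual (B i)"
        using add_cgenideal_upper(2)[OF Bi b] unfolding BS dual_def by blast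
      \<comment> \<open>Strictness of the dual chain enters here: \<open>c e\<close> is annihilated
        by \<open>B i\<close> but, as \<open>nz\<close> shows, not by \<open>a0\<close>. Adding a
        multiple of it to \<open>q\<close> changes the value at \<open>a0\<close> and keeps those on
        \<open>B i\<close>.\<close>
      then obtain c where c: "c \<in> dual (B i)" "c \<notin> dual (B (Suc i))"
        using strict[of i] Suc(2) by auto
      have cc: "c \<in> carrier R" using c(1) by (simp add: dual_def)
      have cB: "c \<odot>\<^bsub>Q\<^esub> (a \<odot>\<^bsub>Q\<^esub> e) = \<zero>\<^bsub>Q\<^esub>" if "a \<in> B i" for a
        using c(1) that by (rule dualD)
      have dec: "\<exists>y\<in>B i. \<exists>t\<in>carrier R. a = y \<oplus> t \<otimes> a0" if aB: "a \<in> B (Suc i)" for a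
      proof -
        obtain y t where y: "y \<in> B i" and t: "t \<in> carrier R" and a: "a = y \<oplus> t \<otimes> b"
          using aB unfolding BS mem_add_cgenideal by blast
        have yc: "y \<in> carrier R" using y by (rule Bi.Icarr)
        have "a = (y \<oplus> \<ominus> ((t \<otimes> s) \<otimes> x)) \<oplus> (t \<otimes> s) \<otimes> a0"
          unfolding a b_eq using yc t s a0c xc
          by (simp add: R.minus_eq R.r_distr R.r_minus R.m_assoc R.a_ac)
        moreover have "y \<oplus> \<ominus> ((t \<otimes> s) \<otimes> x) \<in> B i"
          using y x t s by (simp add: Bi.I_l_closed)
        ultimately show ?thesis using t s by blast
      qed
      have nz: "c \<odot>\<^bsub>Q\<^esub> (a0 \<odot>\<^bsub>Q\<^esub> e) \<noteq> \<zero>\<^bsub>Q\<^esub>"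
      proof
        assume 0: "c \<odot>\<^bsub>Q\<^esub> (a0 \<odot>\<^bsub>Q\<^esub> e) = \<zero>\<^bsub>Q\<^esub>"
        have "c \<odot>\<^bsub>Q\<^esub> (a \<odot>\<^bsub>Q\<^esub> e) = \<zero>\<^bsub>Q\<^esub>" if aB: "a \<in> B (Suc i)" for a
        proof -
          obtain y t where y: "y \<in> B i" and t: "t \<in> carrier R" and a: "a = y \<oplus> t \<otimes> a0"
            using dec[OF aB] by blast
          show ?thesis
            unfolding a using cB[OF y] Bi.Icarr[OF y] t a0c cc 0
            by (simp add: smult_l_distr smult_r_distr smult_assoc1 smult_swap[of c t])
        qed
        with cc have "c \<in> dual (B (Suc i))" by (rule dualI)
        then show False using c(2) by simp
      qed
      let ?g = "f a0 \<ominus>\<^bsub>Q\<^esub> a0 \<odot>\<^bsub>Q\<^esub> q"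
      have gc: "?g \<in> carrier Q" using f_closed a0(1) a0c q by simp
      have m1: "a \<odot>\<^bsub>Q\<^esub> (c \<odot>\<^bsub>Q\<^esub> (a0 \<odot>\<^bsub>Q\<^esub> e)) = \<zero>\<^bsub>Q\<^esub>" if a: "a \<in> \<mm>" for a
        using cB[OF ma0[OF a]] maximal_closed[OF a] cc a0c
        by (simp add: smult_assoc1 smult_swap[of c a])
      have m2: "a \<odot>\<^bsub>Q\<^esub> ?g = \<zero>\<^bsub>Q\<^esub>" if a: "a \<in> \<mm>" for a
      proof -
        have ac: "a \<in> carrier R" using a by (rule maximal_closed)
        have "f (a \<otimes> a0) = (a \<otimes> a0) \<odot>\<^bsub>Q\<^esub> q"
          using A.I_l_closed[OF a0(1) ac] ma0[OF a] by (rule fq)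
        then show ?thesis
          using f_mult[OF ac a0(1)] f_closed[OF a0(1)] ac a0c q
          by (simp add: smult_r_distr smult_r_minus smult_assoc1 M.minus_eq M.r_neg)
      qed
      obtain t where t: "t \<in> carrier R" and gt: "?g = t \<odot>\<^bsub>Q\<^esub> (c \<odot>\<^bsub>Q\<^esub> (a0 \<odot>\<^bsub>Q\<^esub> e))"
        using simple_socle[OF _ gc nz m1 m2] cc a0c by auto
      let ?d = "t \<odot>\<^bsub>Q\<^esub> (c \<odot>\<^bsub>Q\<^esub> e)"
      have dc: "?d \<in> carrier Q" using t cc by simp
      have fa0: "f a0 = a0 \<odot>\<^bsub>Q\<^esub> (q \<oplus>\<^bsub>Q\<^esub> ?d)"
      proof -
        have "f a0 = a0 \<odot>\<^bsub>Q\<^esub> q \<oplus>\<^bsub>Q\<^esub> ?g"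
          using f_closed[OF a0(1)] a0c q by (simp add: M.minus_eq M.a_ac M.r_neg)
        also have "?g = a0 \<odot>\<^bsub>Q\<^esub> ?d"
          unfolding gt using t cc a0c by (simp add: smult_swap[of a0])
        finally show ?thesis using a0c q dc by (simp add: smult_r_distr)
      qed
      have fB: "f y = y \<odot>\<^bsub>Q\<^esub> (q \<oplus>\<^bsub>Q\<^esub> ?d)" if y: "y \<in> A" "y \<in> B i" for y
      proof -
        have yc: "y \<in> carrier R" using y(1) by (rule A.Icarr)
        have "y \<odot>\<^bsub>Q\<^esub> ?d = \<zero>\<^bsub>Q\<^esub>" using cB[OF y(2)] yc t cc by (simp add: smult_swap[of y])
        then show ?thesis using fq[OF y] yc q dc by (simp add: smult_r_distr)
      qed
      have "f a = a \<odot>\<^bsub>Q\<^esub> (q \<oplus>\<^bsub>Q\<^esub> ?d)" if a: "a \<in> A" "a \<in> B (Suc i)" for a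
      proof -
        obtain y t' where y: "y \<in> B i" and t': "t' \<in> carrier R" and eq: "a = y \<oplus> t' \<otimes> a0"
          using dec[OF a(2)] by blast
        have yc: "y \<in> carrier R" using y by (rule Bi.Icarr)
        have ta: "t' \<otimes> a0 \<in> A" using a0(1) t' by (rule A.I_l_closed)
        \<comment> \<open>Additivity of \<open>f\<close> is available on \<open>A\<close> alone, so
          the summand \<open>y\<close> must be shown to lie in \<open>A\<close> as well as in
          \<open>B i\<close>.\<close>
        have "y = a \<ominus> t' \<otimes> a0"
          unfolding eq using yc t' a0c by (simp add: R.minus_eq R.a_assoc R.r_neg)
        then have yA: "y \<in> A" using a(1) ta by (simp add: R.minus_eq)
        show ?thesis
          unfolding eq using f_add[OF yA ta] f_mult[OF t' a0(1)] fB[OF yA y] fa0 yc t' a0c q dc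
          by (simp add: smult_l_distr smult_assoc1)
      qed
      then show ?thesis using q dc by blast
    qed
  qed
  from this[of l] obtain q where "q \<in> carrier Q" "\<forall>a\<in>A. f a = a \<odot>\<^bsub>Q\<^esub> q"
    using A.a_subset unfolding Bl by (auto simp: Int_absorb2)
  then show thesis using that by blast
qed

end

text \<open>For nonzero socle elements \<open>p = a e\<close> and \<open>p' = b e\<close>,
  irreducibility gives some \<open>z\<close> outside \<open>I\<close> in both \<open>I + (a)\<close>
  and \<open>I + (b)\<close>. Then \<open>z e = r p = s p'\<close> is nonzero, so \<open>s\<close>
  is not in \<open>\<mm>\<close>, which kills \<open>p'\<close>; thus \<open>s\<close> is a unit and
  \<open>p'\<close> is a multiple of \<open>p\<close>.\<close>

lemma (in noetherian_local_ring) simple_socle_module_irreducible: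
  fixes P :: "('a, 'c) module"
  assumes P: "module R P" and e: "e \<in> carrier P"
    and gen: "\<And>p. p \<in> carrier P \<Longrightarrow> \<exists>a\<in>carrier R. p = a \<odot>\<^bsub>P\<^esub> e"
    and ann: "\<And>a. a \<in> carrier R \<Longrightarrow> a \<odot>\<^bsub>P\<^esub> e = \<zero>\<^bsub>P\<^esub> \<longleftrightarrow> a \<in> I"
    and irr: "irreducible_ideal R I" and one: "\<one> \<notin> I" and pow: "ideal_power R \<mm> n \<subseteq> I"
  shows "simple_socle_module R \<mm> P e n"
proof -
  interpret P: module R P by (rule P)
  have I: "ideal I R" using irr unfolding irreducible_ideal_def by simp
  have simple: "\<exists>r\<in>carrier R. p' = r \<odot>\<^bsub>P\<^esub> p"
    if p: "p \<in> carrier P" "p' \<in> carrier P" "p \<noteq> \<zero>\<^bsub>P\<^esub>"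
      and mp: "\<And>a. a \<in> \<mm> \<Longrightarrow> a \<odot>\<^bsub>P\<^esub> p = \<zero>\<^bsub>P\<^esub>" and mp': "\<And>a. a \<in> \<mm> \<Longrightarrow> a \<odot>\<^bsub>P\<^esub> p' = \<zero>\<^bsub>P\<^esub>" for p p'
  proof (cases "p' = \<zero>\<^bsub>P\<^esub>")
    case True
    then show ?thesis using p(1) by (intro bexI[of _ \<zero>]) auto
  next
    case False
    obtain a where a: "a \<in> carrier R" and pa: "p = a \<odot>\<^bsub>P\<^esub> e" using gen[OF p(1)] by blast
    obtain b where b: "b \<in> carrier R" and pb: "p' = b \<odot>\<^bsub>P\<^esub> e" using gen[OF p(2)] by blast
    have "a \<notin> I" "b \<notin> I" using ann[OF a] ann[OF b] p(3) False pa pb by auto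
    then have "I \<subset> I <+>\<^bsub>R\<^esub> PIdl a" "I \<subset> I <+>\<^bsub>R\<^esub> PIdl b"
      using add_cgenideal_upper[OF I a] add_cgenideal_upper[OF I b] by auto
    then have "I \<noteq> (I <+>\<^bsub>R\<^esub> PIdl a) \<inter> (I <+>\<^bsub>R\<^esub> PIdl b)"
      using irr add_cgenideal_upper(1)[OF I a] add_cgenideal_upper(1)[OF I b]
      unfolding irreducible_ideal_def by blast
    then obtain z where z: "z \<in> I <+>\<^bsub>R\<^esub> PIdl a" "z \<in> I <+>\<^bsub>R\<^esub> PIdl b" "z \<notin> I"
      using add_cgenideal_upper(2)[OF I a] add_cgenideal_upper(2)[OF I b] by blast
    have ze: "\<exists>r\<in>carrier R. z \<odot>\<^bsub>P\<^esub> e = r \<odot>\<^bsub>P\<^esub> (c \<odot>\<^bsub>P\<^esub> e)"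
      if c: "c \<in> carrier R" and zc: "z \<in> I <+>\<^bsub>R\<^esub> PIdl c" for c
    proof -
      obtain x r where x: "x \<in> I" and r: "r \<in> carrier R" and eq: "z = x \<oplus> r \<otimes> c"
        using zc unfolding mem_add_cgenideal by blast
      have xc: "x \<in> carrier R" using x by (rule ideal.Icarr[OF I])
      have "x \<odot>\<^bsub>P\<^esub> e = \<zero>\<^bsub>P\<^esub>" using ann[OF xc] x by simp
      then have "z \<odot>\<^bsub>P\<^esub> e = r \<odot>\<^bsub>P\<^esub> (c \<odot>\<^bsub>P\<^esub> e)"
        unfolding eq using xc r c e by (simp add: P.smult_l_distr P.smult_assoc1)
      then show ?thesis using r by blast
    qed
    obtain r where r: "r \<in> carrier R" "z \<odot>\<^bsub>P\<^esub> e = r \<odot>\<^bsub>P\<^esub> p" using ze[OF a z(1)] pa by blast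
    obtain s where s: "s \<in> carrier R" "z \<odot>\<^bsub>P\<^esub> e = s \<odot>\<^bsub>P\<^esub> p'" using ze[OF b z(2)] pb by blast
    have "z \<in> carrier R" using z(1) by (rule ideal.Icarr[OF add_cgenideal_upper(1)[OF I a]])
    then have "z \<odot>\<^bsub>P\<^esub> e \<noteq> \<zero>\<^bsub>P\<^esub>" using ann z(3) by blast
    then have "s \<notin> \<mm>" using mp' s(2) by auto
    then obtain t where t: "t \<in> carrier R" "t \<otimes> s = \<one>" using inverse_outside_maximal s(1) by blast
    have "p' = (t \<otimes> s) \<odot>\<^bsub>P\<^esub> p'" using t p(2) by simp
    also have "\<dots> = t \<odot>\<^bsub>P\<^esub> (r \<odot>\<^bsub>P\<^esub> p)" using t(1) s r p(2) by (simp add: P.smult_assoc1)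
    also have "\<dots> = (t \<otimes> r) \<odot>\<^bsub>P\<^esub> p" using t(1) r(1) p(1) by (simp add: P.smult_assoc1)
    finally show ?thesis using t(1) r(1) by blast
  qed
  show ?thesis
  proof (intro simple_socle_module.intro P noetherian_local_ring_axioms simple_socle_module_axioms.intro)
    show "e \<noteq> \<zero>\<^bsub>P\<^esub>" using ann[OF one_closed] one e by simp
    show "a \<odot>\<^bsub>P\<^esub> e = \<zero>\<^bsub>P\<^esub>" if "a \<in> ideal_power R \<mm> n" for a
      using that pow ideal.Icarr[OF I] ann by blast
  qed (use e simple in blast)+
qed

text \<open>The extension is built from its graph \<open>G\<close> over \<open>L + R x\<close>. If
  an element has two representations, the difference of their coefficients multiplies
  \<open>x\<close> into \<open>L\<close>, and there \<open>compat\<close> equates the two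
  values.\<close>

lemma extend_hom_by_one:
  fixes R (structure) and M :: "('a, 'b) module" and Q :: "('a, 'c) module"
  assumes M: "module R M" and Q: "module R Q" and L: "submodule L R M" and f: "f \<in> module_hom R (M\<lparr>carrier := L\<rparr>) Q"
    and x: "x \<in> carrier M" and q: "q \<in> carrier Q"
    and compat: "\<And>a. a \<in> carrier R \<Longrightarrow> a \<odot>\<^bsub>M\<^esub> x \<in> L \<Longrightarrow> f (a \<odot>\<^bsub>M\<^esub> x) = a \<odot>\<^bsub>Q\<^esub> q"
  obtains L' f' where "submodule L' R M" "L \<subseteq> L'" "x \<in> L'"
    "f' \<in> module_hom R (M\<lparr>carrier := L'\<rparr>) Q" "\<And>y. y \<in> L \<Longrightarrow> f' y = f y" "f' x = q"
proof -
  interpret module R M by (rule M)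
  interpret Q: module R Q by (rule Q)
  note LE = submoduleE[OF L]
  have Lc: "l \<in> carrier M" if "l \<in> L" for l using LE(1) that by auto
  have L0: "\<zero>\<^bsub>M\<^esub> \<in> L" using L by (metis submodule_def subgroup.one_closed monoid.simps(2) add.is_monoid partial_object.select_convs(1))
  have fc: "f l \<in> carrier Q" if "l \<in> L" for l
    using f that unfolding module_hom_on_submodule by auto
  have fa: "f (l \<oplus>\<^bsub>M\<^esub> l') = f l \<oplus>\<^bsub>Q\<^esub> f l'" if "l \<in> L" "l' \<in> L" for l l'
    using f that unfolding module_hom_on_submodule by auto
  have fs: "f (a \<odot>\<^bsub>M\<^esub> l) = a \<odot>\<^bsub>Q\<^esub> f l" if "a \<in> carrier R" "l \<in> L" for a l
    using f that unfolding module_hom_on_submodule by auto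
  define G where "G y z \<longleftrightarrow> (\<exists>l\<in>L. \<exists>a\<in>carrier R. y = l \<oplus>\<^bsub>M\<^esub> a \<odot>\<^bsub>M\<^esub> x \<and> z = f l \<oplus>\<^bsub>Q\<^esub> a \<odot>\<^bsub>Q\<^esub> q)" for y z
  have G_unique: "z = z'" if yz: "G y z" and yz': "G y z'" for y z z'
  proof -
    obtain l a where l: "l \<in> L" "a \<in> carrier R" and y: "y = l \<oplus>\<^bsub>M\<^esub> a \<odot>\<^bsub>M\<^esub> x"
      and z: "z = f l \<oplus>\<^bsub>Q\<^esub> a \<odot>\<^bsub>Q\<^esub> q" using yz unfolding G_def by blast
    obtain l' a' where l': "l' \<in> L" "a' \<in> carrier R" and y': "y = l' \<oplus>\<^bsub>M\<^esub> a' \<odot>\<^bsub>M\<^esub> x"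
      and z': "z' = f l' \<oplus>\<^bsub>Q\<^esub> a' \<odot>\<^bsub>Q\<^esub> q" using yz' unfolding G_def by blast
    have dc: "a \<ominus> a' \<in> carrier R" using l l' by simp
    have sum: "a = (a \<ominus> a') \<oplus> a'" using l(2) l'(2) by (simp add: R.minus_eq R.a_assoc R.l_neg)
    have "l \<oplus>\<^bsub>M\<^esub> ((a \<ominus> a') \<odot>\<^bsub>M\<^esub> x \<oplus>\<^bsub>M\<^esub> a' \<odot>\<^bsub>M\<^esub> x) = l' \<oplus>\<^bsub>M\<^esub> a' \<odot>\<^bsub>M\<^esub> x"
      using y y' sum smult_l_distr[OF dc l'(2) x] by simp
    then have eq: "l \<oplus>\<^bsub>M\<^esub> (a \<ominus> a') \<odot>\<^bsub>M\<^esub> x = l'"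
      using Lc[OF l(1)] Lc[OF l'(1)] dc l'(2) x
      by (metis M.add.m_assoc M.add.m_closed M.add.r_cancel smult_closed)
    have "(a \<ominus> a') \<odot>\<^bsub>M\<^esub> x = \<ominus>\<^bsub>M\<^esub> l \<oplus>\<^bsub>M\<^esub> l'"
      unfolding eq[symmetric] using Lc[OF l(1)] dc x by (simp add: M.r_neg1)
    then have inL: "(a \<ominus> a') \<odot>\<^bsub>M\<^esub> x \<in> L" using LE(3,5) l l' by simp
    have "f l' = f l \<oplus>\<^bsub>Q\<^esub> (a \<ominus> a') \<odot>\<^bsub>Q\<^esub> q"
      using fa[OF l(1) inL] compat[OF dc inL] unfolding eq by simp
    then have "z' = f l \<oplus>\<^bsub>Q\<^esub> ((a \<ominus> a') \<odot>\<^bsub>Q\<^esub> q \<oplus>\<^bsub>Q\<^esub> a' \<odot>\<^bsub>Q\<^esub> q)"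
      unfolding z' using fc[OF l(1)] dc l' q by (simp add: Q.M.a_assoc)
    also have "\<dots> = z" unfolding z using sum Q.smult_l_distr[OF dc l'(2) q] by simp
    finally show ?thesis by simp
  qed
  have G_add: "G (y \<oplus>\<^bsub>M\<^esub> y') (z \<oplus>\<^bsub>Q\<^esub> z')" if yz: "G y z" and yz': "G y' z'" for y z y' z'
  proof -
    obtain l a where l: "l \<in> L" "a \<in> carrier R" and y: "y = l \<oplus>\<^bsub>M\<^esub> a \<odot>\<^bsub>M\<^esub> x"
      and z: "z = f l \<oplus>\<^bsub>Q\<^esub> a \<odot>\<^bsub>Q\<^esub> q" using yz unfolding G_def by blast
    obtain l' a' where l': "l' \<in> L" "a' \<in> carrier R" and y': "y' = l' \<oplus>\<^bsub>M\<^esub> a' \<odot>\<^bsub>M\<^esub> x"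
      and z': "z' = f l' \<oplus>\<^bsub>Q\<^esub> a' \<odot>\<^bsub>Q\<^esub> q" using yz' unfolding G_def by blast
    have "y \<oplus>\<^bsub>M\<^esub> y' = (l \<oplus>\<^bsub>M\<^esub> l') \<oplus>\<^bsub>M\<^esub> (a \<oplus> a') \<odot>\<^bsub>M\<^esub> x"
      unfolding y y' using Lc l l' x by (simp add: smult_l_distr M.a_ac)
    moreover have "z \<oplus>\<^bsub>Q\<^esub> z' = f (l \<oplus>\<^bsub>M\<^esub> l') \<oplus>\<^bsub>Q\<^esub> (a \<oplus> a') \<odot>\<^bsub>Q\<^esub> q"
      unfolding z z' using fc l l' q by (simp add: fa Q.smult_l_distr Q.M.a_ac)
    ultimately show ?thesis unfolding G_def using LE(5)[OF l(1) l'(1)] l(2) l'(2) by blast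
  qed
  have G_smult: "G (b \<odot>\<^bsub>M\<^esub> y) (b \<odot>\<^bsub>Q\<^esub> z)" if yz: "G y z" and b: "b \<in> carrier R" for b y z
  proof -
    obtain l a where l: "l \<in> L" "a \<in> carrier R" and y: "y = l \<oplus>\<^bsub>M\<^esub> a \<odot>\<^bsub>M\<^esub> x"
      and z: "z = f l \<oplus>\<^bsub>Q\<^esub> a \<odot>\<^bsub>Q\<^esub> q" using yz unfolding G_def by blast
    have "b \<odot>\<^bsub>M\<^esub> y = b \<odot>\<^bsub>M\<^esub> l \<oplus>\<^bsub>M\<^esub> (b \<otimes> a) \<odot>\<^bsub>M\<^esub> x"
      unfolding y using Lc l x b by (simp add: smult_r_distr smult_assoc1)
    moreover have "b \<odot>\<^bsub>Q\<^esub> z = f (b \<odot>\<^bsub>M\<^esub> l) \<oplus>\<^bsub>Q\<^esub> (b \<otimes> a) \<odot>\<^bsub>Q\<^esub> q"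
      unfolding z using fc l q b by (simp add: fs Q.smult_r_distr Q.smult_assoc1)
    ultimately show ?thesis unfolding G_def using LE(4)[OF b l(1)] l(2) b by blast
  qed
  have G_L: "G l (f l)" if l: "l \<in> L" for l
  proof -
    have "l = l \<oplus>\<^bsub>M\<^esub> \<zero> \<odot>\<^bsub>M\<^esub> x" "f l = f l \<oplus>\<^bsub>Q\<^esub> \<zero> \<odot>\<^bsub>Q\<^esub> q"
      using Lc[OF l] fc[OF l] x q by simp_all
    then show ?thesis unfolding G_def using l R.zero_closed by blast
  qed
  have f0: "f \<zero>\<^bsub>M\<^esub> = \<zero>\<^bsub>Q\<^esub>" using fs[OF R.zero_closed L0] fc[OF L0] Lc[OF L0] by simp
  have G_x: "G x q"
  proof -
    have "x = \<zero>\<^bsub>M\<^esub> \<oplus>\<^bsub>M\<^esub> \<one> \<odot>\<^bsub>M\<^esub> x" "q = f \<zero>\<^bsub>M\<^esub> \<oplus>\<^bsub>Q\<^esub> \<one> \<odot>\<^bsub>Q\<^esub> q"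
      using x q f0 by simp_all
    then show ?thesis unfolding G_def using L0 R.one_closed by blast
  qed
  define L' where "L' = {y. \<exists>z. G y z}"
  define f' where "f' y = (THE z. G y z)" for y
  have f'_eq: "f' y = z" if "G y z" for y z
    unfolding f'_def using that G_unique by blast
  have f'_G: "G y (f' y)" if "y \<in> L'" for y using that f'_eq unfolding L'_def by auto
  have G_carrier: "y \<in> carrier M" "z \<in> carrier Q" if "G y z" for y z
    using that Lc fc x q unfolding G_def by auto
  show thesis
  proof
    show "submodule L' R M"
    proof (rule submodule_criterion)
      show "L' \<subseteq> carrier M" using G_carrier unfolding L'_def by blast
      show "\<zero>\<^bsub>M\<^esub> \<in> L'" using G_L[OF L0] unfolding L'_def by blast
      show "y \<oplus>\<^bsub>M\<^esub> y' \<in> L'" if "y \<in> L'" "y' \<in> L'" for y y'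
        using G_add that unfolding L'_def by blast
      show "a \<odot>\<^bsub>M\<^esub> y \<in> L'" if "a \<in> carrier R" "y \<in> L'" for a y
        using G_smult that unfolding L'_def by blast
    qed
    show "L \<subseteq> L'" using G_L unfolding L'_def by blast
    show "x \<in> L'" using G_x unfolding L'_def by blast
    show "f' \<in> module_hom R (M\<lparr>carrier := L'\<rparr>) Q"
      unfolding module_hom_on_submodule
      using G_carrier(2)[OF f'_G] f'_eq[OF G_add[OF f'_G f'_G]] f'_eq[OF G_smult[OF f'_G]] by simp
    show "f' y = f y" if "y \<in> L" for y using f'_eq[OF G_L[OF that]] .
    show "f' x = q" using f'_eq[OF G_x] .
  qed
qed

text \<open>Generators of \<open>M\<close> are adjoined one at a time; the value at a new generator
  \<open>x\<close> comes from Baer's criterion for \<open>a \<mapsto> f1 (a x)\<close> on the colon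
  ideal \<open>L1 : x\<close>. Because \<open>vanish\<close> places all products of
  \<open>Ann(e)\<close> with \<open>M\<close> already in \<open>L\<close>, each intermediate
  extension still kills them, as the criterion demands.\<close>

lemma (in simple_socle_module) extend_hom_to_fin_gen:
  fixes M :: "('a, 'd) module"
  assumes M: "module R M" and fg: "finitely_generated R M"
    and L: "submodule L R M" and f: "f \<in> module_hom R (M\<lparr>carrier := L\<rparr>) Q"
    and vanish: "\<And>a x. \<lbrakk>a \<in> carrier R; x \<in> carrier M; a \<odot>\<^bsub>Q\<^esub> e = \<zero>\<^bsub>Q\<^esub>\<rbrakk>
      \<Longrightarrow> a \<odot>\<^bsub>M\<^esub> x \<in> L \<and> f (a \<odot>\<^bsub>M\<^esub> x) = \<zero>\<^bsub>Q\<^esub>"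
  obtains g where "g \<in> module_hom R M Q" "\<And>x. x \<in> L \<Longrightarrow> g x = f x"
proof -
  interpret M: module R M by (rule M)
  have Q: "module R Q" by unfold_locales
  have ext: "\<exists>L' f'. submodule L' R M \<and> L \<subseteq> L' \<and> S \<subseteq> L' \<and>
      f' \<in> module_hom R (M\<lparr>carrier := L'\<rparr>) Q \<and> (\<forall>y\<in>L. f' y = f y)"
    if "finite S" "S \<subseteq> carrier M" for S
    using that
  proof (induct S)
    case empty
    then show ?case using L f by blast
  next
    case (insert x S)
    then obtain L1 f1 where L1: "submodule L1 R M" and sub: "L \<subseteq> L1" "S \<subseteq> L1"
      and f1: "f1 \<in> module_hom R (M\<lparr>carrier := L1\<rparr>) Q" and f1f: "\<And>y. y \<in> L \<Longrightarrow> f1 y = f y"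
      by auto
    have x: "x \<in> carrier M" using insert by simp
    let ?A = "{a \<in> carrier R. a \<odot>\<^bsub>M\<^esub> x \<in> L1}"
    obtain q where q: "q \<in> carrier Q" and qf: "\<And>a. a \<in> ?A \<Longrightarrow> f1 (a \<odot>\<^bsub>M\<^esub> x) = a \<odot>\<^bsub>Q\<^esub> q"
    proof (rule baer_criterion[where f = "\<lambda>a. f1 (a \<odot>\<^bsub>M\<^esub> x)"])
      show "ideal ?A R" using L1 x by (rule M.submodule_annihilator_ideal)
      show "f1 (a \<odot>\<^bsub>M\<^esub> x) \<in> carrier Q" if "a \<in> ?A" for a
        using f1 that unfolding module_hom_on_submodule by auto
      show "f1 ((a \<oplus> b) \<odot>\<^bsub>M\<^esub> x) = f1 (a \<odot>\<^bsub>M\<^esub> x) \<oplus>\<^bsub>Q\<^esub> f1 (b \<odot>\<^bsub>M\<^esub> x)" if "a \<in> ?A" "b \<in> ?A" for a b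
        using f1 that x unfolding module_hom_on_submodule by (simp add: M.smult_l_distr)
      show "f1 ((r \<otimes> a) \<odot>\<^bsub>M\<^esub> x) = r \<odot>\<^bsub>Q\<^esub> f1 (a \<odot>\<^bsub>M\<^esub> x)" if "r \<in> carrier R" "a \<in> ?A" for r a
        using f1 that x unfolding module_hom_on_submodule by (simp add: M.smult_assoc1)
      show "f1 (a \<odot>\<^bsub>M\<^esub> x) = \<zero>\<^bsub>Q\<^esub>" if "a \<in> ?A" "a \<odot>\<^bsub>Q\<^esub> e = \<zero>\<^bsub>Q\<^esub>" for a
        using vanish[of a x] f1f that x by simp
    qed (rule that)
    have compat: "f1 (a \<odot>\<^bsub>M\<^esub> x) = a \<odot>\<^bsub>Q\<^esub> q" if "a \<in> carrier R" "a \<odot>\<^bsub>M\<^esub> x \<in> L1" for a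
      using qf that by simp
    show ?case
    proof (rule extend_hom_by_one[OF M Q L1 f1 x q compat])
      fix L' f' assume "submodule L' R M" "L1 \<subseteq> L'" "x \<in> L'"
        "f' \<in> module_hom R (M\<lparr>carrier := L'\<rparr>) Q" "\<And>y. y \<in> L1 \<Longrightarrow> f' y = f1 y"
      then show ?thesis using sub f1f by (intro exI[of _ L'] exI[of _ f']) auto
    qed
  qed
  obtain S where "finite S" "S \<subseteq> carrier M"
    and S: "\<Inter> {N. submodule N R M \<and> S \<subseteq> N} = carrier M"
    using fg unfolding finitely_generated_def by blast
  then obtain L' g where L': "submodule L' R M" "S \<subseteq> L'"
    and g: "g \<in> module_hom R (M\<lparr>carrier := L'\<rparr>) Q" "\<forall>y\<in>L. g y = f y"
    using ext[of S] by auto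
  have "L' = carrier M" using S L' M.submoduleE(1)[OF L'(1)] by blast
  then show thesis using that[of g] g by simp
qed

section \<open>Separating an element from zero\<close>

definition maximal_avoiding :: "('a, 'r) ring_scheme \<Rightarrow> ('a, 'b) module \<Rightarrow> 'b \<Rightarrow> 'b set \<Rightarrow> bool" where
  "maximal_avoiding R M u N \<longleftrightarrow> submodule N R M \<and> u \<in> carrier M \<and> u \<notin> N \<and>
     (\<forall>N'. submodule N' R M \<longrightarrow> N \<subset> N' \<longrightarrow> u \<in> N')"

lemma exists_maximal_avoiding:
  assumes "module R M" "u \<in> carrier M" "u \<noteq> \<zero>\<^bsub>M\<^esub>"
  shows "\<exists>N. maximal_avoiding R M u N"
proof -
  interpret module R M by fact
  let ?\<A> = "{N. submodule N R M \<and> u \<notin> N}"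
  have "\<exists>N\<in>?\<A>. \<forall>N'\<in>?\<A>. N \<subseteq> N' \<longrightarrow> N' = N"
  proof (rule subset_Zorn)
    fix \<C> assume \<C>: "subset.chain ?\<A> \<C>"
    show "\<exists>U\<in>?\<A>. \<forall>N\<in>\<C>. N \<subseteq> U"
    proof (cases "\<C> = {}")
      case True
      then show ?thesis using zero_submodule assms(3) by (intro bexI[of _ "{\<zero>\<^bsub>M\<^esub>}"]) auto
    next
      case False
      have "subset.chain {N. submodule N R M} \<C>" using \<C> unfolding pred_on.chain_def by auto
      then have "submodule (\<Union>\<C>) R M" using False by (rule submodule_Union_chain)
      moreover have "u \<notin> \<Union>\<C>" using \<C> unfolding pred_on.chain_def by auto
      ultimately show ?thesis by (intro bexI[of _ "\<Union>\<C>"]) auto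
    qed
  qed
  then obtain N where "submodule N R M" "u \<notin> N"
    and max: "\<And>N'. submodule N' R M \<Longrightarrow> u \<notin> N' \<Longrightarrow> N \<subseteq> N' \<Longrightarrow> N' = N" by auto
  then show ?thesis using assms(2) unfolding maximal_avoiding_def by blast
qed

context noetherian_local_ring
begin

lemma smult_unit_mem_submodule:
  assumes M: "module R M" and N: "submodule N R M" and u: "u \<in> carrier M"
    and a: "a \<in> carrier R" "a \<notin> \<mm>" and au: "a \<odot>\<^bsub>M\<^esub> u \<in> N"
  shows "u \<in> N"
proof -
  interpret M: module R M by (rule M)
  obtain b where b: "b \<in> carrier R" "b \<otimes> a = \<one>" using inverse_outside_maximal a by blast
  then have "b \<odot>\<^bsub>M\<^esub> (a \<odot>\<^bsub>M\<^esub> u) = u" using a u by (simp flip: M.smult_assoc1)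
  then show ?thesis using M.submoduleE(4)[OF N b(1) au] by simp
qed

context
  fixes M :: "('a, 'd) module" and u N
  assumes M: "module R M" and N: "maximal_avoiding R M u N"
begin

interpretation M: module R M by (rule M)

lemma maximal_avoiding_decomp:
  assumes "y \<in> carrier M" "y \<notin> N"
  obtains z c where "z \<in> N" "c \<in> carrier R" "u = z \<oplus>\<^bsub>M\<^esub> c \<odot>\<^bsub>M\<^esub> y"
proof -
  have N': "submodule N R M" using N unfolding maximal_avoiding_def by simp
  have "u \<in> {z \<oplus>\<^bsub>M\<^esub> c \<odot>\<^bsub>M\<^esub> y | z c. z \<in> N \<and> c \<in> carrier R}"
    using M.submodule_insert[OF N' assms(1)] assms(2) N unfolding maximal_avoiding_def by blast
  then show thesis using that by blast
qed

text \<open>Nakayama's argument: otherwise \<open>u\<close> lies in \<open>N + R a u\<close>, so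
  \<open>(1 - c a) u\<close> is in \<open>N\<close> for some \<open>c\<close>, and
  \<open>1 - c a\<close> is a unit.\<close>

lemma maximal_ideal_smult_avoided:
  assumes a: "a \<in> \<mm>"
  shows "a \<odot>\<^bsub>M\<^esub> u \<in> N"
proof (rule ccontr)
  assume notin: "a \<odot>\<^bsub>M\<^esub> u \<notin> N"
  have N': "submodule N R M" and u: "u \<in> carrier M" "u \<notin> N"
    using N unfolding maximal_avoiding_def by simp_all
  have ac: "a \<in> carrier R" using a by (rule ideal.Icarr[OF maximal_ideal])
  have auc: "a \<odot>\<^bsub>M\<^esub> u \<in> carrier M" using ac u by simp
  obtain z c where z: "z \<in> N" and c: "c \<in> carrier R" and eq: "u = z \<oplus>\<^bsub>M\<^esub> c \<odot>\<^bsub>M\<^esub> (a \<odot>\<^bsub>M\<^esub> u)"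
    using maximal_avoiding_decomp[OF auc notin] by blast
  have zc: "z \<in> carrier M" using z M.submoduleE(1)[OF N'] by auto
  have "(\<one> \<ominus> c \<otimes> a) \<odot>\<^bsub>M\<^esub> u = u \<ominus>\<^bsub>M\<^esub> c \<odot>\<^bsub>M\<^esub> (a \<odot>\<^bsub>M\<^esub> u)"
    using c ac u by (simp add: M.smult_diff M.smult_assoc1)
  also have "\<dots> = z"
    using eq zc c auc
    by (metis M.M.minus_eq M.M.a_assoc M.M.r_neg M.M.r_zero M.M.a_inv_closed M.smult_closed)
  finally have "(\<one> \<ominus> c \<otimes> a) \<odot>\<^bsub>M\<^esub> u \<in> N" using z by simp
  moreover have "\<one> \<ominus> c \<otimes> a \<notin> \<mm>"
  proof
    interpret \<mm>: ideal \<mm> R by (rule maximal_ideal)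
    assume "\<one> \<ominus> c \<otimes> a \<in> \<mm>"
    then have "(\<one> \<ominus> c \<otimes> a) \<oplus> c \<otimes> a \<in> \<mm>" using \<mm>.I_l_closed[OF a c] by simp
    moreover have "(\<one> \<ominus> c \<otimes> a) \<oplus> c \<otimes> a = \<one>" using c ac by (simp add: minus_eq a_assoc l_neg)
    ultimately show False using one_notin_maximal by simp
  qed
  moreover have "\<one> \<ominus> c \<otimes> a \<in> carrier R" using c ac by simp
  ultimately have "u \<in> N" using smult_unit_mem_submodule[OF M N' u(1)] by blast
  then show False using u by simp
qed

text \<open>The ascending chain of the ideals \<^term>\<open>{c. c \<odot>\<^bsub>M\<^esub> (a [^] k \<odot>\<^bsub>M\<^esub> x) \<in> N}\<close> becomes stationary at
  some \<^term>\<open>k\<close>, and then \<^term>\<open>u\<close> cannot lie in the submodule generated by \<^term>\<open>N\<close> and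
  \<^term>\<open>a [^] k \<odot>\<^bsub>M\<^esub> x\<close>.\<close>

lemma maximal_ideal_nilpotent_mod_avoiding:
  assumes a: "a \<in> \<mm>" and x: "x \<in> carrier M"
  shows "\<exists>k::nat. a [^] k \<odot>\<^bsub>M\<^esub> x \<in> N"
proof -
  have N': "submodule N R M" and u: "u \<in> carrier M" "u \<notin> N"
    using N unfolding maximal_avoiding_def by simp_all
  note NE = M.submoduleE[OF N']
  have ac: "a \<in> carrier R" using a by (rule ideal.Icarr[OF maximal_ideal])
  define I where "I k = {c \<in> carrier R. c \<odot>\<^bsub>M\<^esub> (a [^] k \<odot>\<^bsub>M\<^esub> x) \<in> N}" for k :: nat
  have "ideal (I k) R" for k
    unfolding I_def using N' by (rule M.submodule_annihilator_ideal) (use ac x in simp)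
  then have "range I \<subseteq> {I. ideal I R}" by blast
  then obtain P where P: "P \<in> range I" and max: "\<And>I'. I' \<in> range I \<Longrightarrow> P \<subseteq> I' \<Longrightarrow> I' = P"
    using maximal_ideal_in_family[of "range I"] by blast
  then obtain k where Pk: "P = I k" by blast
  have k: "I j = I k" if "I k \<subseteq> I j" for j
    using max[of "I j"] that unfolding Pk by simp
  have shift: "c \<odot>\<^bsub>M\<^esub> (a [^] Suc k \<odot>\<^bsub>M\<^esub> x) = a \<odot>\<^bsub>M\<^esub> (c \<odot>\<^bsub>M\<^esub> (a [^] k \<odot>\<^bsub>M\<^esub> x))" if c: "c \<in> carrier R" for c
  proof -
    have "a [^] Suc k \<odot>\<^bsub>M\<^esub> x = a \<odot>\<^bsub>M\<^esub> (a [^] k \<odot>\<^bsub>M\<^esub> x)"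
      using ac x by (simp add: M.smult_assoc1 M.smult_swap[of _ a])
    then show ?thesis using c ac x by (metis M.smult_swap M.smult_closed nat_pow_closed)
  qed
  have "I k \<subseteq> I (Suc k)"
  proof
    fix c assume "c \<in> I k"
    then show "c \<in> I (Suc k)" using shift[of c] NE(4)[OF ac] unfolding I_def by simp
  qed
  then have Ik: "I (Suc k) = I k" by (rule k)
  have "a [^] k \<odot>\<^bsub>M\<^esub> x \<in> N"
  proof (rule ccontr)
    assume notin: "a [^] k \<odot>\<^bsub>M\<^esub> x \<notin> N"
    have yc: "a [^] k \<odot>\<^bsub>M\<^esub> x \<in> carrier M" using ac x by simp
    obtain z c where z: "z \<in> N" and c: "c \<in> carrier R"
      and eq: "u = z \<oplus>\<^bsub>M\<^esub> c \<odot>\<^bsub>M\<^esub> (a [^] k \<odot>\<^bsub>M\<^esub> x)"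
      using maximal_avoiding_decomp[OF yc notin] by blast
    let ?w = "c \<odot>\<^bsub>M\<^esub> (a [^] k \<odot>\<^bsub>M\<^esub> x)"
    have wc: "?w \<in> carrier M" using yc c by simp
    have zc: "z \<in> carrier M" using z NE(1) by auto
    \<comment> \<open>Both \<open>z\<close> and \<open>a u\<close> are in \<open>N\<close> up to
      multiplication by \<open>a\<close>, the latter by \<open>maximal_ideal_smult_avoided\<close>.
      So \<open>a\<close> carries \<open>?w\<close> into \<open>N\<close>, which puts
      \<open>c\<close> into the next ideal of the stationary chain.\<close>
    have "a \<odot>\<^bsub>M\<^esub> ?w = \<ominus>\<^bsub>M\<^esub> (a \<odot>\<^bsub>M\<^esub> z) \<oplus>\<^bsub>M\<^esub> a \<odot>\<^bsub>M\<^esub> u"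
      unfolding eq using ac zc wc by (simp add: M.smult_r_distr M.M.r_neg1)
    then have "a \<odot>\<^bsub>M\<^esub> ?w \<in> N"
      using NE(3)[OF NE(4)[OF ac z]] maximal_ideal_smult_avoided[OF a] NE(5) by simp
    then have "c \<in> I (Suc k)" using c shift[OF c] unfolding I_def by simp
    then have "c \<in> I k" by (simp only: Ik)
    then have "?w \<in> N" by (simp add: I_def)
    then have "u \<in> N" unfolding eq using z NE(5) by blast
    then show False using u by simp
  qed
  then show ?thesis by blast
qed

text \<open>For a single \<open>x\<close>, the ideal \<open>\<mm>\<close> lies in the radical of
  \<open>N : x\<close>, so a power of \<open>\<mm>\<close> carries \<open>x\<close> into
  \<open>N\<close>. Finitely many generators share an exponent, and the elements carried into
  \<open>N\<close> by that power form a submodule.\<close>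

lemma power_smult_avoiding:
  assumes fg: "finitely_generated R M"
  obtains n where "\<And>a x. a \<in> ideal_power R \<mm> n \<Longrightarrow> x \<in> carrier M \<Longrightarrow> a \<odot>\<^bsub>M\<^esub> x \<in> N"
proof -
  have N': "submodule N R M" using N unfolding maximal_avoiding_def by simp
  note NE = M.submoduleE[OF N']
  have ex: "\<exists>n. \<forall>a\<in>ideal_power R \<mm> n. a \<odot>\<^bsub>M\<^esub> x \<in> N" if x: "x \<in> carrier M" for x
  proof -
    let ?A = "{a \<in> carrier R. a \<odot>\<^bsub>M\<^esub> x \<in> N}"
    have "\<mm> \<subseteq> radical R ?A"
      using maximal_ideal_nilpotent_mod_avoiding[OF _ x] ideal.Icarr[OF maximal_ideal]
      unfolding radical_def by auto
    then obtain n where "ideal_power R \<mm> n \<subseteq> ?A"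
      using ideal_power_subset_if_subset_radical[OF noetherian_ring_axioms maximal_ideal
          M.submodule_annihilator_ideal[OF N' x]] by blast
    then show ?thesis by blast
  qed
  obtain S where S: "finite S" "S \<subseteq> carrier M"
    and gen: "\<Inter> {N. submodule N R M \<and> S \<subseteq> N} = carrier M"
    using fg unfolding finitely_generated_def by blast
  obtain k where k: "\<And>x a. x \<in> S \<Longrightarrow> a \<in> ideal_power R \<mm> (k x) \<Longrightarrow> a \<odot>\<^bsub>M\<^esub> x \<in> N"
    using bchoice[of S "\<lambda>x n. \<forall>a\<in>ideal_power R \<mm> n. a \<odot>\<^bsub>M\<^esub> x \<in> N"] ex S(2) by blast
  \<comment> \<open>Inserting \<open>0\<close> keeps \<open>Max\<close> meaningful when
    \<open>S\<close> is empty.\<close>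
  define n where "n = Max (insert 0 (k ` S))"
  define N1 where "N1 = {x \<in> carrier M. \<forall>a\<in>ideal_power R \<mm> n. a \<odot>\<^bsub>M\<^esub> x \<in> N}"
  have pc: "a \<in> carrier R" if "a \<in> ideal_power R \<mm> n" for a
    using that ideal.Icarr[OF ideal_ideal_power[OF maximal_ideal]] by blast
  have "S \<subseteq> N1"
  proof
    fix x assume x: "x \<in> S"
    have "k x \<le> n" unfolding n_def using S(1) x by auto
    then have "ideal_power R \<mm> n \<subseteq> ideal_power R \<mm> (k x)"
      by (rule ideal_power_antimono[OF maximal_ideal])
    then show "x \<in> N1" using k[OF x] x S(2) unfolding N1_def by blast
  qed
  moreover have "submodule N1 R M"
  proof (rule M.submodule_criterion)
    show "\<zero>\<^bsub>M\<^esub> \<in> N1" unfolding N1_def using pc M.submodule_zero[OF N'] by simp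
    show "x \<oplus>\<^bsub>M\<^esub> y \<in> N1" if "x \<in> N1" "y \<in> N1" for x y
      using that pc NE(5) unfolding N1_def by (simp add: M.smult_r_distr)
    show "b \<odot>\<^bsub>M\<^esub> x \<in> N1" if "b \<in> carrier R" "x \<in> N1" for b x
      using that pc NE(4) unfolding N1_def by (simp add: M.smult_swap[of _ b])
  qed (auto simp: N1_def)
  ultimately have "carrier M \<subseteq> N1" using gen by blast
  then show thesis using that unfolding N1_def by blast
qed

end

end

text \<open>Sending \<open>N\<close> to zero and \<open>u\<close> to a nonzero socle element is well
  defined: since \<open>u \<notin> N\<close>, every \<open>a\<close> with \<open>a u \<in> N\<close>
  is a nonunit, hence in \<open>\<mm>\<close>, which annihilates the socle. The hypothesis
  \<open>vanish\<close> then allows the extension to \<open>M\<close>.\<close>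

lemma (in simple_socle_module) separating_hom:
  fixes M :: "('a, 'd) module"
  assumes M: "module R M" and fg: "finitely_generated R M"
    and N: "submodule N R M" and u: "u \<in> carrier M" "u \<notin> N"
    and vanish: "\<And>a x. \<lbrakk>a \<in> carrier R; x \<in> carrier M; a \<odot>\<^bsub>Q\<^esub> e = \<zero>\<^bsub>Q\<^esub>\<rbrakk> \<Longrightarrow> a \<odot>\<^bsub>M\<^esub> x \<in> N"
  obtains g where "g \<in> module_hom R M Q" "g u \<noteq> \<zero>\<^bsub>Q\<^esub>"
proof -
  interpret M: module R M by (rule M)
  have Q: "module R Q" by unfold_locales
  let ?J = "{a \<in> carrier R. a \<odot>\<^bsub>Q\<^esub> e \<in> {\<zero>\<^bsub>Q\<^esub>}}"
  have J: "ideal ?J R"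
    by (rule submodule_annihilator_ideal[OF zero_submodule element_closed])
  have "\<one> \<notin> ?J" using element_nonzero by simp
  moreover have "ideal_power R \<mm> n \<subseteq> ?J"
    using power_annihilates ideal.Icarr[OF ideal_ideal_power[OF maximal_ideal]] by blast
  ultimately obtain b where b: "b \<in> carrier R" "b \<notin> ?J" and mb: "\<And>a. a \<in> \<mm> \<Longrightarrow> a \<otimes> b \<in> ?J"
    using exists_socle_element[OF J] by blast
  let ?s = "b \<odot>\<^bsub>Q\<^esub> e"
  have s: "?s \<in> carrier Q" "?s \<noteq> \<zero>\<^bsub>Q\<^esub>" using b by auto
  have ms: "a \<odot>\<^bsub>Q\<^esub> ?s = \<zero>\<^bsub>Q\<^esub>" if "a \<in> \<mm>" for a
    using mb[OF that] maximal_closed[OF that] b(1) by (simp add: smult_assoc1)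
  have 0: "(\<lambda>_. \<zero>\<^bsub>Q\<^esub>) \<in> module_hom R (M\<lparr>carrier := N\<rparr>) Q"
    unfolding module_hom_on_submodule by simp
  have compat: "\<zero>\<^bsub>Q\<^esub> = a \<odot>\<^bsub>Q\<^esub> ?s" if a: "a \<in> carrier R" "a \<odot>\<^bsub>M\<^esub> u \<in> N" for a
  proof -
    have "a \<in> \<mm>" using smult_unit_mem_submodule[OF M N u(1) a(1) _ a(2)] u(2) by blast
    then show ?thesis by (simp add: ms)
  qed
  show thesis
  proof (rule extend_hom_by_one[OF M Q N 0 u(1) s(1) compat])
    fix L f assume L: "submodule L R M" "N \<subseteq> L" "u \<in> L"
      and f: "f \<in> module_hom R (M\<lparr>carrier := L\<rparr>) Q" and fN: "\<And>y. y \<in> N \<Longrightarrow> f y = \<zero>\<^bsub>Q\<^esub>"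
      and fu: "f u = ?s"
    show thesis
    proof (rule extend_hom_to_fin_gen[OF M fg L(1) f])
      show "a \<odot>\<^bsub>M\<^esub> x \<in> L \<and> f (a \<odot>\<^bsub>M\<^esub> x) = \<zero>\<^bsub>Q\<^esub>"
        if "a \<in> carrier R" "x \<in> carrier M" "a \<odot>\<^bsub>Q\<^esub> e = \<zero>\<^bsub>Q\<^esub>" for a x
        using vanish[OF that] L(2) fN by auto
      fix g assume g: "g \<in> module_hom R M Q" and gL: "\<And>x. x \<in> L \<Longrightarrow> g x = f x"
      then show thesis using that[OF g] gL[OF L(3)] fu s(2) by simp
    qed
  qed
qed

section \<open>Closures\<close>

lemma regular_module_simps:
  assumes "inj_on \<iota> (carrier R)"
  shows "carrier (regular_module R \<iota>) = \<iota> ` carrier R"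
    "\<zero>\<^bsub>regular_module R \<iota>\<^esub> = \<iota> \<zero>\<^bsub>R\<^esub>"
    "\<lbrakk>a \<in> carrier R; b \<in> carrier R\<rbrakk> \<Longrightarrow> \<iota> a \<oplus>\<^bsub>regular_module R \<iota>\<^esub> \<iota> b = \<iota> (a \<oplus>\<^bsub>R\<^esub> b)"
    "b \<in> carrier R \<Longrightarrow> a \<odot>\<^bsub>regular_module R \<iota>\<^esub> \<iota> b = \<iota> (a \<otimes>\<^bsub>R\<^esub> b)"
  using assms by (simp_all add: regular_module_def Let_def)

lemma (in cring) module_regular_module:
  fixes \<iota> :: "'a \<Rightarrow> 'c"
  assumes \<iota>: "inj_on \<iota> (carrier R)"
  shows "module R (regular_module R \<iota>)"
proof -
  \<comment> \<open>This is \<open>R\<close> on its own elements; checking the module axioms here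
    and transporting them keeps the inverse of \<open>\<iota>\<close> out of the
    calculation.\<close>
  define M :: "('a, 'a) module" where "M = \<lparr>carrier = carrier R, monoid.mult = (\<otimes>), one = \<one>,
    zero = \<zero>, add = (\<oplus>), smult = (\<otimes>)\<rparr>"
  have "abelian_group M"
    by (rule abelian_groupI) (auto simp: M_def a_assoc intro: a_comm l_neg)
  then have "module R M"
    by (intro moduleI is_cring) (auto simp: M_def l_distr r_distr m_assoc)
  then show ?thesis
    by (rule module_transport(1)[where q = \<iota>]) (simp_all add: M_def regular_module_simps[OF \<iota>])
qed

lemma (in cring) finitely_generated_regular_module:
  assumes \<iota>: "inj_on \<iota> (carrier R)"
  shows "finitely_generated R (regular_module R \<iota>)"
proof (rule cyclic_finitely_generated[OF module_regular_module[OF \<iota>]])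
  show "\<iota> \<one> \<in> carrier (regular_module R \<iota>)" by (simp add: regular_module_simps[OF \<iota>])
  show "\<exists>a\<in>carrier R. p = a \<odot>\<^bsub>regular_module R \<iota>\<^esub> \<iota> \<one>"
    if "p \<in> carrier (regular_module R \<iota>)" for p
    using that by (auto simp: regular_module_simps[OF \<iota>])
qed

lemma (in cring) submodule_regular_module:
  assumes \<iota>: "inj_on \<iota> (carrier R)" and I: "ideal I R"
  shows "submodule (\<iota> ` I) R (regular_module R \<iota>)"
proof -
  interpret I: ideal I R by (rule I)
  interpret M: module R "regular_module R \<iota>" using \<iota> by (rule module_regular_module)
  note simps = regular_module_simps[OF \<iota>]
  show ?thesis
  proof (rule M.submodule_criterion)
    show "x \<oplus>\<^bsub>regular_module R \<iota>\<^esub> y \<in> \<iota> ` I" if "x \<in> \<iota> ` I" "y \<in> \<iota> ` I" for x y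
      using that by (auto simp: simps)
    show "a \<odot>\<^bsub>regular_module R \<iota>\<^esub> x \<in> \<iota> ` I" if "a \<in> carrier R" "x \<in> \<iota> ` I" for a x
      using that by (auto simp: simps I.I_l_closed)
  qed (use I.a_subset in \<open>auto simp: simps\<close>)
qed

lemma (in cring) exists_cyclic_quotient:
  fixes \<iota> :: "'a \<Rightarrow> 'c"
  assumes \<iota>: "inj_on \<iota> (carrier R)" and I: "ideal I R"
  obtains P :: "('a, 'c) module" and q where "module R P" "finitely_generated R P"
    "q \<in> module_surj R (regular_module R \<iota>) P"
    "{x \<in> carrier (regular_module R \<iota>). q x = \<zero>\<^bsub>P\<^esub>} = \<iota> ` I"
    "q (\<iota> \<one>) \<in> carrier P" "\<And>p. p \<in> carrier P \<Longrightarrow> \<exists>a\<in>carrier R. p = a \<odot>\<^bsub>P\<^esub> q (\<iota> \<one>)"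
    "\<And>a. a \<in> carrier R \<Longrightarrow> a \<odot>\<^bsub>P\<^esub> q (\<iota> \<one>) = q (\<iota> a)"
    "\<And>a. a \<in> carrier R \<Longrightarrow> q (\<iota> a) = \<zero>\<^bsub>P\<^esub> \<longleftrightarrow> a \<in> I"
proof -
  note simps = regular_module_simps[OF \<iota>]
  let ?M = "regular_module R \<iota>"
  show thesis
  proof (rule exists_quotient_module[OF module_regular_module[OF \<iota>] submodule_regular_module[OF \<iota> I]])
    fix P :: "('a, 'c) module" and q
    assume P: "module R P" and q: "q \<in> module_surj R ?M P"
      and ker: "{x \<in> carrier ?M. q x = \<zero>\<^bsub>P\<^esub>} = \<iota> ` I"
    interpret P: module R P by (rule P)
    have qc: "q (\<iota> a) \<in> carrier P" if "a \<in> carrier R" for a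
      using q that unfolding module_surj_def module_hom_def by (auto simp: simps)
    have smult: "a \<odot>\<^bsub>P\<^esub> q (\<iota> \<one>) = q (\<iota> a)" if a: "a \<in> carrier R" for a
    proof -
      have "q (a \<odot>\<^bsub>?M\<^esub> \<iota> \<one>) = a \<odot>\<^bsub>P\<^esub> q (\<iota> \<one>)"
        using q a one_closed unfolding module_surj_def module_hom_def simps by blast
      then show ?thesis using a by (simp add: simps)
    qed
    have gen: "\<exists>a\<in>carrier R. p = a \<odot>\<^bsub>P\<^esub> q (\<iota> \<one>)" if p: "p \<in> carrier P" for p
    proof -
      have "p \<in> q ` \<iota> ` carrier R" using p q unfolding module_surj_def by (simp add: simps)
      then show ?thesis using smult by auto
    qed
    have fg: "finitely_generated R P"
      using P qc[OF one_closed] gen by (rule cyclic_finitely_generated)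
    have "q (\<iota> a) = \<zero>\<^bsub>P\<^esub> \<longleftrightarrow> a \<in> I" if a: "a \<in> carrier R" for a
    proof -
      have "q (\<iota> a) = \<zero>\<^bsub>P\<^esub> \<longleftrightarrow> \<iota> a \<in> \<iota> ` I" using ker a by (auto simp: simps)
      also have "\<dots> \<longleftrightarrow> a \<in> I"
        using inj_on_image_mem_iff[OF \<iota> a] ideal.Icarr[OF I] by auto
      finally show ?thesis .
    qed
    with P fg q ker qc gen smult show thesis using that by simp
  qed
qed

section \<open>Closedness of zero and of all ideals\<close>

lemma (in noetherian_local_ring) fin_gen_zero_closed:
  fixes \<iota> :: "'a \<Rightarrow> 'c" and M :: "('a, 'c) module"
  assumes \<iota>: "inj_on \<iota> (carrier R)"
    and cl: "closure_operation R C cl" and functorial: "functorial R C cl"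
    and residual: "residual R C cl"
    and irr: "\<And>t. irreducible_ideal R (J t)" and proper: "\<And>t. \<one> \<notin> J t"
    and cofinal: "cofinal_with_powers R \<mm> J"
    and closed: "\<And>t. ideal_closure R \<iota> cl (J t) = J t"
    and M: "module R M" and fg: "finitely_generated R M"
  shows "cl M {\<zero>\<^bsub>M\<^esub>} = {\<zero>\<^bsub>M\<^esub>}"
proof (rule ccontr)
  interpret closure_operation R C cl by (rule cl)
  interpret M: module R M by (rule M)
  assume "cl M {\<zero>\<^bsub>M\<^esub>} \<noteq> {\<zero>\<^bsub>M\<^esub>}"
  moreover have MC: "M \<in> C" using M fg by (rule fin_gen)
  ultimately obtain u where u: "u \<in> cl M {\<zero>\<^bsub>M\<^esub>}" "u \<noteq> \<zero>\<^bsub>M\<^esub>"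
    using cl_extensive[OF MC M.zero_submodule] by blast
  then have uc: "u \<in> carrier M" using M.submoduleE(1)[OF cl_submodule[OF MC M.zero_submodule]] by auto
  obtain N where N: "maximal_avoiding R M u N"
    using exists_maximal_avoiding[OF M uc u(2)] by blast
  obtain n where n: "\<And>a x. a \<in> ideal_power R \<mm> n \<Longrightarrow> x \<in> carrier M \<Longrightarrow> a \<odot>\<^bsub>M\<^esub> x \<in> N"
    using power_smult_avoiding[OF M N fg] by blast
  \<comment> \<open>The two halves of cofinality serve different ends: \<open>J t\<close> inside the
    \<open>n\<close>-th power of \<open>\<mm>\<close> makes \<open>J t M\<close> vanish modulo
    \<open>N\<close>, and a power of \<open>\<mm>\<close> inside \<open>J t\<close> gives
    \<open>R / J t\<close> finite length.\<close>
  obtain t where t: "J t \<subseteq> ideal_power R \<mm> n"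
    using cofinal unfolding cofinal_with_powers_def by blast
  obtain k where k: "ideal_power R \<mm> k \<subseteq> J t"
    using cofinal unfolding cofinal_with_powers_def by blast
  have Jt: "ideal (J t) R" using irr unfolding irreducible_ideal_def by blast
  let ?M = "regular_module R \<iota>"
  show False
  proof (rule exists_cyclic_quotient[OF \<iota> Jt])
    fix P :: "('a, 'c) module" and q
    assume P: "module R P" and Pfg: "finitely_generated R P"
      and q: "q \<in> module_surj R ?M P"
      and ker: "{x \<in> carrier ?M. q x = \<zero>\<^bsub>P\<^esub>} = \<iota> ` J t"
      and e: "q (\<iota> \<one>) \<in> carrier P" and gen: "\<And>p. p \<in> carrier P \<Longrightarrow> \<exists>a\<in>carrier R. p = a \<odot>\<^bsub>P\<^esub> q (\<iota> \<one>)"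
      and smult: "\<And>a. a \<in> carrier R \<Longrightarrow> a \<odot>\<^bsub>P\<^esub> q (\<iota> \<one>) = q (\<iota> a)"
      and zero: "\<And>a. a \<in> carrier R \<Longrightarrow> q (\<iota> a) = \<zero>\<^bsub>P\<^esub> \<longleftrightarrow> a \<in> J t"
    interpret P: simple_socle_module R \<mm> P "q (\<iota> \<one>)" k
    proof (rule simple_socle_module_irreducible[OF P e gen _ irr[of t] proper[of t] k])
      show "a \<odot>\<^bsub>P\<^esub> q (\<iota> \<one>) = \<zero>\<^bsub>P\<^esub> \<longleftrightarrow> a \<in> J t" if "a \<in> carrier R" for a
        using smult[OF that] zero[OF that] by simp
    qed
    have vanish: "a \<odot>\<^bsub>M\<^esub> x \<in> N"
      if "a \<in> carrier R" "x \<in> carrier M" "a \<odot>\<^bsub>P\<^esub> q (\<iota> \<one>) = \<zero>\<^bsub>P\<^esub>" for a x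
      using that smult zero t n by auto
    have "submodule N R M" "u \<notin> N" using N unfolding maximal_avoiding_def by simp_all
    then obtain g where g: "g \<in> module_hom R M P" "g u \<noteq> \<zero>\<^bsub>P\<^esub>"
      using P.separating_hom[OF M fg _ uc _ vanish] by blast
    have g_zero: "g \<zero>\<^bsub>M\<^esub> \<in> carrier P" "g (\<zero> \<odot>\<^bsub>M\<^esub> \<zero>\<^bsub>M\<^esub>) = \<zero> \<odot>\<^bsub>P\<^esub> g \<zero>\<^bsub>M\<^esub>"
      using g(1) M.M.zero_closed zero_closed unfolding module_hom_def by blast+
    then have g0: "g \<zero>\<^bsub>M\<^esub> = \<zero>\<^bsub>P\<^esub>" by simp
    have PC: "P \<in> C" using P Pfg by (rule fin_gen)
    have "g ` cl M {\<zero>\<^bsub>M\<^esub>} \<subseteq> cl P (g ` {\<zero>\<^bsub>M\<^esub>})"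
      using functorial MC PC g(1) M.zero_submodule unfolding functorial_def by blast
    then have gu: "g u \<in> cl P {\<zero>\<^bsub>P\<^esub>}" using u(1) g0 by auto
    have guc: "g u \<in> carrier P" using g(1) uc unfolding module_hom_def by auto
    \<comment> \<open>Lifting \<open>g u\<close> to \<open>R\<close> turns membership in the closure
      of zero in \<open>R / J t\<close> into membership in the closure of \<open>J t\<close>, by
      residuality along \<open>q\<close>.\<close>
    obtain a where a: "a \<in> carrier R" "g u = q (\<iota> a)"
      using gen[OF guc] smult by auto
    have MC': "?M \<in> C"
      using module_regular_module[OF \<iota>] finitely_generated_regular_module[OF \<iota>] by (rule fin_gen)
    have "cl ?M (\<iota> ` J t) = {x \<in> carrier ?M. q x \<in> cl P {\<zero>\<^bsub>P\<^esub>}}"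
      using residual[unfolded residual_def, rule_format, OF MC' PC q] unfolding ker .
    then have "\<iota> a \<in> cl ?M (\<iota> ` J t)" using gu a by (simp add: regular_module_simps[OF \<iota>])
    then have "a \<in> J t" using closed[of t] a(1) unfolding ideal_closure_def by blast
    then show False using zero[OF a(1)] a(2) g(2) by simp
  qed
qed

lemma (in cring) ideal_closed_if_fin_gen_zero_closed:
  fixes \<iota> :: "'a \<Rightarrow> 'c"
  assumes \<iota>: "inj_on \<iota> (carrier R)"
    and cl: "closure_operation R C cl" and residual: "residual R C cl"
    and zero_closed: "\<And>P :: ('a, 'c) module. module R P \<Longrightarrow> finitely_generated R P \<Longrightarrow>
      cl P {\<zero>\<^bsub>P\<^esub>} = {\<zero>\<^bsub>P\<^esub>}"
    and I: "ideal I R"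
  shows "ideal_closure R \<iota> cl I = I"
proof -
  interpret closure_operation R C cl by (rule cl)
  let ?M = "regular_module R \<iota>"
  show ?thesis
  proof (rule exists_cyclic_quotient[OF \<iota> I])
    fix P :: "('a, 'c) module" and q
    assume P: "module R P" "finitely_generated R P"
      and q: "q \<in> module_surj R ?M P"
      and ker: "{x \<in> carrier ?M. q x = \<zero>\<^bsub>P\<^esub>} = \<iota> ` I"
    have PC: "P \<in> C" using P by (rule fin_gen)
    have MC: "?M \<in> C"
      using module_regular_module[OF \<iota>] finitely_generated_regular_module[OF \<iota>] by (rule fin_gen)
    have "cl ?M (\<iota> ` I) = {x \<in> carrier ?M. q x \<in> cl P {\<zero>\<^bsub>P\<^esub>}}"
      using residual[unfolded residual_def, rule_format, OF MC PC q] unfolding ker .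
    also have "\<dots> = \<iota> ` I" using zero_closed[OF P] ker by simp
    finally show ?thesis
      unfolding ideal_closure_def using ideal.Icarr[OF I] inj_onD[OF \<iota>] by auto
  qed
qed

theorem corollary3p5:
  fixes R :: "('a, 'r) ring_scheme"
    and \<mm> :: "'a set"
    and \<iota> :: "'a \<Rightarrow> 'b"
    and C :: "('a, 'b) module set"
    and cl :: "('a, 'b) module \<Rightarrow> 'b set \<Rightarrow> 'b set"
    and J :: "nat \<Rightarrow> 'a set"
  assumes "approximately_gorenstein R \<mm>"
    and "adically_complete R \<mm>"
    and "inj_on \<iota> (carrier R)"
    and "closure_operation R C cl"
    and "functorial R C cl"
    and "residual R C cl"
    and "\<And>t. irreducible_ideal R (J t)"
    and "\<And>t. primary_to R \<mm> (J t)"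
    and "cofinal_with_powers R \<mm> J"
    and "\<And>t. ideal_closure R \<iota> cl (J t) = J t"
  shows "(\<forall>I. ideal I R \<longrightarrow> ideal_closure R \<iota> cl I = I) \<and>
         (\<forall>M :: ('a, 'b) module. module R M \<longrightarrow> finitely_generated R M \<longrightarrow>
            cl M {\<zero>\<^bsub>M\<^esub>} = {\<zero>\<^bsub>M\<^esub>})"
proof -
  interpret noetherian_local_ring R \<mm>
    using assms(1) unfolding approximately_gorenstein_def by simp
  \<comment> \<open>The predicate \<open>irreducible_ideal\<close> holds for the unit ideal too, so
    properness has to be read off from primariness.\<close>
  have "\<one>\<^bsub>R\<^esub> \<notin> J t" for t
    using assms(8)[of t] ideal.one_imp_carrier
    unfolding primary_to_def primary_ideal_def by blast
  then have zero: "cl M {\<zero>\<^bsub>M\<^esub>} = {\<zero>\<^bsub>M\<^esub>}"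
    if "module R M" "finitely_generated R M" for M :: "('a, 'b) module"
    using fin_gen_zero_closed[OF assms(3-7) _ assms(9,10) that] by blast
  then have "ideal_closure R \<iota> cl I = I" if "ideal I R" for I
    using ideal_closed_if_fin_gen_zero_closed[OF assms(3,4,6) _ that] by blast
  with zero show ?thesis by blast
qed

end
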